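(* For every integer $n\ge 1$, the polynomial $F_n(z)$ has only real zeros. Consequently, for all integers $1\le r\le n$, the polynomial $F_{r1^{n-r}}(z)$ is log-concave; that is, $F_\pi(z)$ is log-concave for every permutation $\pi\in\mathfrak{S}_n$ having at most one cycle of length greater than $1$.
   Context: $\mathfrak{S}_n$ is the symmetric group on $\{1,\dots,n\}$, $Q_n\subseteq\mathfrak{S}_n$ is the set of $n$-cycles, and $c(\eta)$ denotes the number of cycles (including fixed points) of a permutation $\eta$. Permutations are multiplied from left to right. For $\pi\in\mathfrak{S}_n$, $F_\pi(z)=\sum_{\zeta\in Q_n} z^{\lfloor (c(\zeta\pi)-1)/2\rfloor}$; this depends only on the type (multiset of cycle lengths) of $\pi$, and $F_\lambda:=F_\pi$ for $\pi$ of type $\lambda$. $F_n(z)$ denotes $F_\pi(z)$ for $\pi$ an $n$-cycle. The partition $r1^{n-r}$ has one part $r$ and $n-r$ parts equal to $1$. A polynomial $\sum_k a_kz^k$ with nonnegative coefficients is log-concave if $a_k^2\ge a_{k-1}a_{k+1}$ for all $k$. *)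

theory Defs
  imports
    "HOL-Combinatorics.Orbits"
    "HOL-Computational_Algebra.Polynomial"
    "HOL-Library.Multiset"
    Complex_Main
begin

text \<open>The symmetric group on \<open>{1..n}\<close> consists of the functions \<open>p :: nat \<Rightarrow> nat\<close> with
  \<open>p permutes {1..n}\<close>.\<close>

definition cycles_of :: "nat \<Rightarrow> (nat \<Rightarrow> nat) \<Rightarrow> nat set set" where
  "cycles_of n p = orbit p ` {1..n}"

definition num_cycles :: "nat \<Rightarrow> (nat \<Rightarrow> nat) \<Rightarrow> nat" where
  "num_cycles n p = card (cycles_of n p)"

definition cycle_type :: "nat \<Rightarrow> (nat \<Rightarrow> nat) \<Rightarrow> nat multiset" where
  "cycle_type n p = image_mset card (mset_set (cycles_of n p))"

definition n_cycles :: "nat \<Rightarrow> (nat \<Rightarrow> nat) set" where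
  "n_cycles n = {p. p permutes {1..n} \<and> cyclic_on p {1..n}}"

text \<open>Permutations are multiplied from left to right, so the product \<open>\<zeta>\<pi>\<close>
  is the function \<open>\<pi> \<circ> \<zeta>\<close>. For \<open>n \<ge> 1\<close> every permutation has at least one
  cycle, hence the subtraction below does not truncate.\<close>

definition F_poly :: "nat \<Rightarrow> (nat \<Rightarrow> nat) \<Rightarrow> real poly" where
  "F_poly n \<pi> = (\<Sum>\<zeta>\<in>n_cycles n. monom 1 ((num_cycles n (\<pi> \<circ> \<zeta>) - 1) div 2))"

definition only_real_zeros :: "real poly \<Rightarrow> bool" where
  "only_real_zeros p \<longleftrightarrow>
     (\<forall>z::complex. poly (map_poly complex_of_real p) z = 0 \<longrightarrow> z \<in> \<real>)"

text \<open>The instance \<open>k = 0\<close> of the inequality is trivial, since the coefficient of index \<open>-1\<close>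
  is \<open>0\<close>.\<close>

definition log_concave_poly :: "real poly \<Rightarrow> bool" where
  "log_concave_poly p \<longleftrightarrow>
     (\<forall>k. coeff p k \<ge> 0) \<and>
     (\<forall>k\<ge>1. (coeff p k)\<^sup>2 \<ge> coeff p (k - 1) * coeff p (k + 1))"

end

theory Submission
  imports Defs "HOL-Computational_Algebra.Fundamental_Theorem_Algebra"
begin

text \<open>
  Fix an \<open>n\<close>-cycle \<open>\<pi>\<close> of \<open>S\<close> and a point \<open>x\<close> of \<open>S\<close>. A permutation \<open>\<eta>\<close> is an
  \<open>n\<close>-cycle iff the sum of \<open>(-1)\<close> to the number of cycles in \<open>A\<close>, over all
  \<open>\<eta>\<close>-invariant \<open>A \<subseteq> S - {x}\<close>, is \<open>1\<close>, and otherwise this sum is \<open>0\<close>. Insert this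
  indicator for \<open>\<eta> = inv \<pi> \<circ> w\<close> into the sum of \<open>q ^ c(w)\<close> over all permutations \<open>w\<close> and
  exchange the two sums. Every \<open>A\<close> with two points outside \<open>\<pi> ` A\<close> contributes \<open>0\<close>, so only
  the empty set and the arcs of \<open>\<pi>\<close> remain. For an arc, \<open>w\<close> is a transposition times a
  permutation preserving \<open>A\<close>, and the contribution is a product of two rising factorials.
  Telescoping yields
  \<open>n (n+1) \<Sum> q ^ c(\<zeta>\<pi>) = q (q+1) \<dots> (q+n) - q (q-1) \<dots> (q-n)\<close>.
  All zeros \<open>q\<close> of the right-hand side are purely imaginary, since otherwise the two products
  have different absolute values; and the left-hand side is \<open>F\<^sub>n(q\<^sup>2)\<close> up to a constant and a power
  of \<open>q\<close>, by parity. So \<open>F\<^sub>n\<close> has only real nonpositive zeros and is log-concave. A fixed point of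
  \<open>\<pi>\<close> only multiplies the polynomial by a positive constant.
\<close>

subsection \<open>Counting cycles\<close>

text \<open>The carrier is a parameter because cycles are later counted on subsets and on sets
  extended by a point. A fixed point of \<open>p\<close> in \<open>S\<close> counts as a
  cycle.\<close>

definition cycle_count :: "'a set \<Rightarrow> ('a \<Rightarrow> 'a) \<Rightarrow> nat" where
  "cycle_count S p = card (orbit p ` S)"

lemma permutation_orbit_eqI:
  assumes "permutation p" "y \<in> orbit p x"
  shows "orbit p y = orbit p x"
  using cyclic_on_orbit'[OF assms(1), of x] assms(2) by (rule orbit_cyclic_eq3)

lemma orbit_subsetI_invariant:
  assumes "x \<in> T" "\<And>y. y \<in> T \<Longrightarrow> p y \<in> T"
  shows "orbit p x \<subseteq> T"
proof
  fix y assume "y \<in> orbit p x"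
  then show "y \<in> T" by induction (use assms in auto)
qed

text \<open>Along \<open>orbit p a\<close> the modified permutation differs from \<open>p\<close>
  only at the predecessor of \<open>a\<close>, since \<open>b\<close> is not met there. The walk
  from \<open>a\<close> therefore visits the whole old cycle before it leaves it.\<close>

lemma orbit_subset_orbit_transpose_comp:
  assumes p: "permutation p" and ab: "b \<notin> orbit p a"
  shows "orbit p a \<subseteq> orbit (transpose a b \<circ> p) a"
proof
  let ?q = "transpose a b \<circ> p"
  have q: "permutation ?q"
    using p by (intro permutation_compose permutation_swap_id)
  have reach: "p y \<in> orbit ?q a" if "y \<in> orbit ?q a" "p y \<noteq> b" for y
  proof (cases "p y = a")
    case True
    then show ?thesis using permutation_self_in_orbit[OF q] by simp
  next
    case False
    then have "?q y = p y" using that by (simp add: transpose_def)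
    then show ?thesis using orbit.step[OF that(1)] by simp
  qed
  fix y assume "y \<in> orbit p a"
  then show "y \<in> orbit ?q a"
  proof induction
    case base
    show ?case
      by (intro reach permutation_self_in_orbit q) (use ab orbit.base[of p a] in auto)
  next
    case (step y)
    then show ?case
      using reach[OF step.IH] ab orbit.step[OF step.hyps] by metis
  qed
qed

lemma orbit_transpose_comp:
  assumes p: "permutation p" and ab: "b \<notin> orbit p a"
  shows "orbit (transpose a b \<circ> p) a = orbit p a \<union> orbit p b"
    and "orbit (transpose a b \<circ> p) b = orbit p a \<union> orbit p b"
proof -
  let ?q = "transpose a b \<circ> p"
  have q: "permutation ?q"
    using p by (intro permutation_compose permutation_swap_id)
  have ba: "a \<notin> orbit p b"
    using ab orbit_swap[OF permutation_self_in_orbit[OF p]] by metis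
  have sub_a: "orbit p a \<subseteq> orbit ?q a"
    by (rule orbit_subset_orbit_transpose_comp[OF p ab])
  have sub_b: "orbit p b \<subseteq> orbit ?q b"
    using orbit_subset_orbit_transpose_comp[OF p ba] by (simp add: transpose_commute)
  \<comment> \<open>The predecessor of \<open>a\<close> is where the new walk jumps to
    \<open>b\<close>; this links the two old cycles.\<close>
  have "inv p a \<in> orbit (inv p) a" by (rule orbit.base)
  then have "inv p a \<in> orbit ?q a"
    using sub_a orbit_inv_eq[OF p] by auto
  then have "?q (inv p a) \<in> orbit ?q a" by (rule orbit.step)
  moreover have "?q (inv p a) = b"
    using permutation_bijective[OF p] by (simp add: bij_is_surj surj_f_inv_f)
  ultimately have eq: "orbit ?q b = orbit ?q a"
    using permutation_orbit_eqI[OF q] by simp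
  have "orbit ?q a \<subseteq> orbit p a \<union> orbit p b"
  proof (rule orbit_subsetI_invariant)
    show "a \<in> orbit p a \<union> orbit p b" using permutation_self_in_orbit[OF p] by simp
    fix y assume "y \<in> orbit p a \<union> orbit p b"
    then have "p y \<in> orbit p a \<union> orbit p b" by (auto intro: orbit.step)
    then show "?q y \<in> orbit p a \<union> orbit p b"
      using permutation_self_in_orbit[OF p] by (auto simp: transpose_def)
  qed
  then show "orbit ?q a = orbit p a \<union> orbit p b" using sub_a sub_b eq by auto
  then show "orbit ?q b = orbit p a \<union> orbit p b" using eq by simp
qed

text \<open>The cycles of \<open>a\<close> and \<open>b\<close> are replaced by their union, and
  every other cycle survives unchanged.\<close>

lemma cycle_count_transpose_comp:
  assumes S: "finite S" and pS: "p permutes S" and "a \<in> S" "b \<in> S" and ab: "b \<notin> orbit p a"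
  shows "Suc (cycle_count S (transpose a b \<circ> p)) = cycle_count S p"
proof -
  let ?q = "transpose a b \<circ> p" and ?U = "orbit p a \<union> orbit p b"
  have p: "permutation p" using S pS by (rule permutes_imp_permutation)
  have self: "x \<in> orbit p x" for x by (rule permutation_self_in_orbit[OF p])
  have q: "permutation ?q"
    using p by (intro permutation_compose permutation_swap_id)
  have other: "orbit ?q x = orbit p x" if "x \<notin> ?U" for x
  proof (rule orbit_cong[OF self])
    fix s assume s: "s \<in> orbit p x"
    have eq: "orbit p (p s) = orbit p x"
      using permutation_orbit_eqI[OF p orbit.step[OF s]] .
    then have "p s \<noteq> a" "p s \<noteq> b" using that self[of x] by auto
    then show "?q s = p s" by (simp add: transpose_def)
  qed
  have inU: "orbit ?q x = ?U" if "x \<in> ?U" for x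
    using that permutation_orbit_eqI[OF q] orbit_transpose_comp[OF p ab] by metis
  have "orbit p x \<noteq> orbit p a" "orbit p x \<noteq> orbit p b" if "x \<notin> ?U" for x
    using that self[of x] by auto
  then have rest: "orbit p ` (S - ?U) = orbit p ` S - {orbit p a, orbit p b}"
    using permutation_orbit_eqI[OF p] by blast
  have "orbit ?q ` S = orbit ?q ` (S - ?U) \<union> orbit ?q ` (S \<inter> ?U)" by blast
  also have "orbit ?q ` (S - ?U) = orbit p ` (S - ?U)"
    using other by (intro image_cong) auto
  also have "orbit ?q ` (S \<inter> ?U) = {?U}"
    using inU self[of a] \<open>a \<in> S\<close> by (auto simp: image_iff)
  finally have "orbit ?q ` S = insert ?U (orbit p ` S - {orbit p a, orbit p b})"
    unfolding rest by (simp only: Un_insert_right Un_empty_right)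
  moreover have "?U \<notin> orbit p ` (S - ?U)" using self by auto
  ultimately have "cycle_count S ?q = Suc (card (orbit p ` S - {orbit p a, orbit p b}))"
    unfolding cycle_count_def using S rest by simp
  moreover have "card (orbit p ` S - {orbit p a, orbit p b}) = cycle_count S p - 2"
  proof -
    have "orbit p a \<noteq> orbit p b" using ab self[of b] by auto
    then have "card {orbit p a, orbit p b} = 2" by simp
    then show ?thesis unfolding cycle_count_def
      using \<open>a \<in> S\<close> \<open>b \<in> S\<close> by (subst card_Diff_subset) auto
  qed
  \<comment> \<open>Ensures that the subtraction of 2 above does not truncate.\<close>
  moreover have "2 \<le> cycle_count S p"
  proof -
    have "orbit p a \<noteq> orbit p b" using ab self[of b] by auto
    then have "card {orbit p a, orbit p b} = 2" by simp
    moreover have "{orbit p a, orbit p b} \<subseteq> orbit p ` S" using \<open>a \<in> S\<close> \<open>b \<in> S\<close> by auto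
    ultimately show ?thesis unfolding cycle_count_def using S
      by (metis card_mono finite_imageI)
  qed
  ultimately show ?thesis by simp
qed

lemma cycle_count_Un:
  assumes "finite A" "finite B" "A \<inter> B = {}" "u permutes A" "v permutes B"
  shows "cycle_count (A \<union> B) (u \<circ> v) = cycle_count A u + cycle_count B v"
proof -
  have A: "orbit (u \<circ> v) x = orbit u x" if "x \<in> A" for x
  proof (rule orbit_cong0[symmetric, OF that])
    show "u \<in> A \<rightarrow> A" using assms(4) by (auto simp: permutes_in_image)
    fix y assume "y \<in> A"
    then have "v y = y" using assms(3,5) by (intro permutes_not_in) auto
    then show "u y = (u \<circ> v) y" by simp
  qed
  have B: "orbit (u \<circ> v) x = orbit v x" if "x \<in> B" for x
  proof (rule orbit_cong0[symmetric, OF that])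
    show vB: "v \<in> B \<rightarrow> B" using assms(5) by (auto simp: permutes_in_image)
    fix y assume "y \<in> B"
    then have "v y \<in> B" using vB by auto
    then have "u (v y) = v y" using assms(3,4) by (intro permutes_not_in) auto
    then show "v y = (u \<circ> v) y" by simp
  qed
  have "orbit (u \<circ> v) ` (A \<union> B) = orbit u ` A \<union> orbit v ` B"
    unfolding image_Un by (intro arg_cong2[of _ _ _ _ "(\<union>)"] image_cong A B) auto
  moreover have "orbit u ` A \<inter> orbit v ` B = {}"
  proof -
    have "orbit u x \<noteq> orbit v y" if "x \<in> A" "y \<in> B" for x y
      using permutes_orbit_subset[OF assms(4) that(1)] permutes_orbit_subset[OF assms(5) that(2)]
        orbit_nonempty[of u x] assms(3) by blast
    then show ?thesis by blast
  qed
  ultimately show ?thesis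
    unfolding cycle_count_def using assms(1,2) by (simp add: card_Un_disjoint)
qed

lemma cycle_count_insert:
  assumes "finite S" "a \<notin> S" "p permutes S"
  shows "cycle_count (insert a S) p = Suc (cycle_count S p)"
proof -
  have "cycle_count (S \<union> {a}) (p \<circ> id) = cycle_count S p + cycle_count {a} id"
    using assms by (intro cycle_count_Un) (auto simp: permutes_id)
  then show ?thesis by (simp add: cycle_count_def)
qed

text \<open>The new point \<open>a\<close> alone would be an additional cycle; the transposition
  merges it into the cycle of \<open>b\<close>, so gain and loss cancel.\<close>

lemma cycle_count_insert_transpose:
  assumes "finite S" "a \<notin> S" "p permutes S" "b \<in> S"
  shows "cycle_count (insert a S) (transpose a b \<circ> p) = cycle_count S p"
proof -
  have "p a = a" using assms by (intro permutes_not_in)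
  then have "orbit p a = {a}" by (simp add: orbit_eq_singleton_iff)
  then have "Suc (cycle_count (insert a S) (transpose a b \<circ> p)) = cycle_count (insert a S) p"
    using assms by (intro cycle_count_transpose_comp) (auto intro: permutes_imp_permutes_insert)
  then show ?thesis using assms by (simp add: cycle_count_insert)
qed


section \<open>Rising factorials and signs in terms of cycle counts\<close>

lemma sum_power_cycle_count:
  fixes x :: "'b::comm_semiring_1"
  assumes "finite S"
  shows "(\<Sum>p | p permutes S. x ^ cycle_count S p) = pochhammer x (card S)"
  using assms
proof (induction S rule: finite_induct)
  case empty
  then show ?case by (simp add: cycle_count_def)
next
  case (insert a S)
  have "(\<Sum>p | p permutes insert a S. x ^ cycle_count (insert a S) p) =
      (\<Sum>b\<in>insert a S. \<Sum>p | p permutes S. x ^ cycle_count (insert a S) (transpose a b \<circ> p))"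
    using insert.hyps by (rule sum_over_permutations_insert)
  \<comment> \<open>The choice \<open>b = a\<close> opens a new cycle and costs a factor
    \<open>x\<close>; each of the \<open>card S\<close> other choices inserts \<open>a\<close> into
    an existing cycle. Together they give the next factor \<open>x + card S\<close>.\<close>
  also have "\<dots> = (\<Sum>b\<in>insert a S. (if b = a then x else 1) * pochhammer x (card S))"
  proof (rule sum.cong[OF refl])
    fix b assume "b \<in> insert a S"
    then have "x ^ cycle_count (insert a S) (transpose a b \<circ> p) =
        (if b = a then x else 1) * x ^ cycle_count S p" if "p permutes S" for p
      using that insert.hyps cycle_count_insert[of S a p] cycle_count_insert_transpose[of S a p b]
      by auto
    then show "(\<Sum>p | p permutes S. x ^ cycle_count (insert a S) (transpose a b \<circ> p)) =
        (if b = a then x else 1) * pochhammer x (card S)"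
      by (simp add: insert.IH[symmetric] sum_distrib_left)
  qed
  also have "\<dots> = x * pochhammer x (card S) +
      (\<Sum>b\<in>S. (if b = a then x else 1) * pochhammer x (card S))"
    using insert.hyps by (subst sum.insert) auto
  also have "(\<Sum>b\<in>S. (if b = a then x else 1) * pochhammer x (card S)) =
      (\<Sum>b\<in>S. pochhammer x (card S))"
    using insert.hyps by (intro sum.cong) auto
  also have "x * pochhammer x (card S) + (\<Sum>b\<in>S. pochhammer x (card S)) =
      pochhammer x (card (insert a S))"
    using insert.hyps by (simp add: pochhammer_rec' algebra_simps)
  finally show ?case .
qed

text \<open>Same recursion: \<open>b = a\<close> adds a point and a cycle and keeps the sign, while
  any other \<open>b\<close> adds only a point and flips the sign.\<close>

lemma sign_conv_cycle_count:
  assumes "finite S" "p permutes S"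
  shows "sign p = (-1) ^ (card S + cycle_count S p)"
  using assms
proof (induction S arbitrary: p rule: finite_induct)
  case empty
  then show ?case by (simp add: cycle_count_def)
next
  case (insert a S)
  from insert.prems obtain b q where q: "b \<in> insert a S" "q permutes S" "p = transpose a b \<circ> q"
    using permutes_insert[of a S] by (auto simp: set_eq_iff image_iff)
  have "permutation q" using insert.hyps q by (intro permutes_imp_permutation[of S])
  then have "sign p = (if a = b then 1 else -1) * (-1) ^ (card S + cycle_count S q)"
    using q insert.IH by (simp add: sign_compose permutation_swap_id sign_swap_id)
  moreover have "cycle_count (insert a S) p = (if a = b then 1 else 0) + cycle_count S q"
  proof (cases "a = b")
    case True
    then show ?thesis using q insert.hyps cycle_count_insert[of S a q] by simp
  next
    case False
    then show ?thesis
      unfolding q(3) using q insert.hyps by (subst cycle_count_insert_transpose) auto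
  qed
  ultimately show ?case
    using insert.hyps by auto
qed

subsection \<open>Signed sums over invariant sets\<close>

text \<open>This is the expansion of the product over \<open>X\<close> of the factors (-1) +
  1.\<close>

lemma sum_Pow_minus_one:
  assumes "finite X"
  shows "(\<Sum>T\<in>Pow X. (-1) ^ card T) = (if X = {} then 1 else 0 :: int)"
  using prod_add[OF assms, of "\<lambda>_. -1 :: int" "\<lambda>_. 1"] assms by (simp add: power_0_left)

text \<open>Links two forms of the signed weight: \<open>sign_on\<close> is multiplicative, which
  serves the sums over permutations, while the number of cycles in \<open>A\<close> is what cancels
  over unions of cycles.\<close>

lemma sign_on_conv_card_orbits:
  assumes "finite A" "inj_on f A" "f ` A = A"
  shows "(-1) ^ card A * sign_on A f = (-1) ^ card (orbit f ` A)"
proof -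
  have perm: "restrict_id f A permutes A"
    using assms by (intro permutes_restrict_id) (auto simp: bij_betw_def)
  have "orbit (restrict_id f A) x = orbit f x" if "x \<in> A" for x
    using assms that by (intro orbit_cong0[of x A]) auto
  then have "cycle_count A (restrict_id f A) = card (orbit f ` A)"
    unfolding cycle_count_def by (intro arg_cong[of _ _ card] image_cong) auto
  then show ?thesis
    unfolding sign_on_def sign_conv_cycle_count[OF assms(1) perm] by (simp flip: power_add)
      (simp add: power_add)
qed

text \<open>The sets of cycles avoiding \<open>x\<close> cancel in pairs unless there is only one cycle.\<close>
lemma sum_sign_on_invariant_sets:
  assumes S: "finite S" and \<eta>: "\<eta> permutes S" and x: "x \<in> S"
  shows "(\<Sum>A | A \<subseteq> S - {x} \<and> \<eta> ` A = A. (-1) ^ card A * sign_on A \<eta>) =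
    (if cycle_count S \<eta> = 1 then 1 else 0)"
proof -
  have perm: "permutation \<eta>" using S \<eta> by (rule permutes_imp_permutation)
  have self: "y \<in> orbit \<eta> y" for y by (rule permutation_self_in_orbit[OF perm])
  have inj: "inj_on \<eta> A" for A using permutes_inj_on[OF \<eta>] .
  let ?X = "orbit \<eta> ` S - {orbit \<eta> x}"
  \<comment> \<open>An invariant set is the union of the cycles that it contains, so the sets
    \<open>A\<close> correspond to the sets \<open>T\<close> of cycles other than that of
    \<open>x\<close>.\<close>
  have "(\<Sum>A | A \<subseteq> S - {x} \<and> \<eta> ` A = A. (-1) ^ card A * sign_on A \<eta>) =
    (\<Sum>T\<in>Pow ?X. (-1) ^ card T)"
  proof (rule sum.reindex_bij_witness[of _ Union "\<lambda>A. orbit \<eta> ` A"])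
    fix A assume "A \<in> {A. A \<subseteq> S - {x} \<and> \<eta> ` A = A}"
    then have A: "A \<subseteq> S - {x}" "\<eta> ` A = A" by auto
    have sub: "orbit \<eta> y \<subseteq> A" if "y \<in> A" for y
      using that A(2) by (intro orbit_subsetI_invariant) auto
    then show "\<Union> (orbit \<eta> ` A) = A" using self by blast
    have "orbit \<eta> y \<noteq> orbit \<eta> x" if "y \<in> A" for y
      using sub[OF that] self[of x] A(1) by blast
    then show "orbit \<eta> ` A \<in> Pow ?X" using A(1) by auto
    have "finite A" using A(1) S finite_subset by blast
    then show "(-1) ^ card (orbit \<eta> ` A) = (-1) ^ card A * sign_on A \<eta>"
      using A(2) inj by (simp add: sign_on_conv_card_orbits)
  next
    fix T assume "T \<in> Pow ?X"
    then have T: "T \<subseteq> ?X" by simp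
    have *: "orbit \<eta> y = C" if "C \<in> T" "y \<in> C" for C y
      using T that permutation_orbit_eqI[OF perm] by auto
    show "orbit \<eta> ` \<Union> T = T"
    proof
      show "orbit \<eta> ` \<Union> T \<subseteq> T" using * by auto
      show "T \<subseteq> orbit \<eta> ` \<Union> T"
      proof
        fix C assume "C \<in> T"
        then obtain y where "C = orbit \<eta> y" using T by auto
        then show "C \<in> orbit \<eta> ` \<Union> T" using self[of y] \<open>C \<in> T\<close> by auto
      qed
    qed
    have "x \<notin> C" if "C \<in> T" for C using *[OF that, of x] T that by auto
    moreover have "C \<subseteq> S" if "C \<in> T" for C
      using T that permutes_orbit_subset[OF \<eta>] by auto
    ultimately have sub: "\<Union> T \<subseteq> S - {x}" by blast
    have "\<eta> ` \<Union> T \<subseteq> \<Union> T"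
      using * orbit.base[of \<eta>] by fastforce
    then have "\<eta> ` \<Union> T = \<Union> T"
      using sub S finite_subset inj by (intro endo_inj_surj) blast+
    with sub show "\<Union> T \<in> {A. A \<subseteq> S - {x} \<and> \<eta> ` A = A}" by simp
  qed
  also have "\<dots> = (if ?X = {} then 1 else 0)"
    using S by (intro sum_Pow_minus_one) auto
  also have "?X = {} \<longleftrightarrow> cycle_count S \<eta> = 1"
  proof -
    have "?X = {} \<longleftrightarrow> orbit \<eta> ` S = {orbit \<eta> x}" using x by auto
    also have "\<dots> \<longleftrightarrow> cycle_count S \<eta> = 1"
    proof
      assume "cycle_count S \<eta> = 1"
      then obtain C where "orbit \<eta> ` S = {C}"
        unfolding cycle_count_def by (rule card_1_singletonE)
      then show "orbit \<eta> ` S = {orbit \<eta> x}" using x by blast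
    qed (simp add: cycle_count_def)
    finally show ?thesis .
  qed
  finally show ?thesis .
qed

lemma cycle_count_conjugate:
  assumes "finite S" "p permutes S" "\<tau> permutes S"
  shows "cycle_count S (\<tau> \<circ> p \<circ> inv \<tau>) = cycle_count S p"
proof -
  have perm: "permutation p" using assms by (intro permutes_imp_permutation)
  have eq: "orbit (\<tau> \<circ> p \<circ> inv \<tau>) (\<tau> x) = \<tau> ` orbit p x" for x
    by (rule orbit_inverse[symmetric, OF permutation_self_in_orbit[OF perm]])
       (simp add: permutes_inverses[OF assms(3)])
  have "orbit (\<tau> \<circ> p \<circ> inv \<tau>) ` (\<tau> ` S) = (`) \<tau> ` orbit p ` S"
    unfolding image_image eq ..
  then have "orbit (\<tau> \<circ> p \<circ> inv \<tau>) ` S = (`) \<tau> ` orbit p ` S"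
    by (simp only: permutes_image[OF assms(3)])
  moreover have "inj_on ((`) \<tau>) (orbit p ` S)"
    using permutes_inj[OF assms(3)] by (meson inj_image_eq_iff inj_onI)
  ultimately show ?thesis by (simp only: cycle_count_def card_image)
qed

lemma bij_betw_inv_comp:
  assumes "p permutes S" "w permutes S" "w ` A = p ` A"
  shows "bij_betw (inv p \<circ> w) A A"
proof (rule bij_betw_imageI)
  show "inj_on (inv p \<circ> w) A"
    using assms permutes_inv[OF assms(1)] by (intro permutes_inj_on[of _ S] permutes_compose) auto
  have "(inv p \<circ> w) ` A = inv p ` p ` A" by (simp only: image_comp assms(3)[symmetric])
  then show "(inv p \<circ> w) ` A = A"
    by (simp add: image_image permutes_inverses[OF assms(1)])
qed

text \<open>Two points of \<open>A\<close> outside \<open>\<pi> ` A\<close> give a transposition whose conjugation action on the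
  summands reverses their signs.\<close>
lemma sum_sign_on_eq_0:
  fixes q :: "'b::{idom,ring_char_0}"
  assumes S: "finite S" and \<pi>: "\<pi> permutes S" and AS: "A \<subseteq> S"
    and ab: "a \<in> A" "b \<in> A" "a \<noteq> b" "a \<notin> \<pi> ` A" "b \<notin> \<pi> ` A"
  shows "(\<Sum>w | w permutes S \<and> w ` A = \<pi> ` A. q ^ cycle_count S w * of_int (sign_on A (inv \<pi> \<circ> w))) = 0"
    (is "sum ?f ?W = 0")
proof -
  define \<tau> where "\<tau> = transpose a b"
  have \<tau>S: "\<tau> permutes S" unfolding \<tau>_def using ab AS by (intro permutes_swap_id) auto
  have inv\<tau>: "inv \<tau> = \<tau>" unfolding \<tau>_def by simp
  have \<tau>\<tau>: "\<tau> (\<tau> x) = x" for x unfolding \<tau>_def by simp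
  have \<tau>A: "\<tau> ` A = A"
    unfolding \<tau>_def using ab by (intro permutes_image permutes_swap_id)
  have \<tau>B: "\<tau> y = y" if "y \<in> \<pi> ` A" for y
    using that ab unfolding \<tau>_def by (intro transpose_apply_other) auto
  have W: "\<tau> \<circ> w \<circ> \<tau> \<in> ?W" if "w \<in> ?W" for w
  proof -
    have "(\<tau> \<circ> w \<circ> \<tau>) ` A = \<tau> ` w ` \<tau> ` A" by (simp only: image_comp o_assoc)
    also have "\<dots> = \<tau> ` \<pi> ` A" using that \<tau>A by simp
    also have "\<dots> = id ` \<pi> ` A" using \<tau>B by (intro image_cong) auto
    finally show ?thesis using that \<tau>S by (auto intro!: permutes_compose)
  qed
  have sgn: "sign_on A (inv \<pi> \<circ> (\<tau> \<circ> w \<circ> \<tau>)) = - sign_on A (inv \<pi> \<circ> w)" if "w \<in> ?W" for w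
  proof -
    have bij: "bij_betw (inv \<pi> \<circ> w) A A"
      using that by (intro bij_betw_inv_comp[OF \<pi>]) auto
    have "sign_on A (inv \<pi> \<circ> (\<tau> \<circ> w \<circ> \<tau>)) = sign_on A ((inv \<pi> \<circ> w) \<circ> \<tau>)"
    proof (rule sign_on_cong[OF refl])
      fix x assume "x \<in> A"
      then have "\<tau> x \<in> A" using \<tau>A by blast
      then have "w (\<tau> x) \<in> \<pi> ` A" using that by blast
      then show "(inv \<pi> \<circ> (\<tau> \<circ> w \<circ> \<tau>)) x = ((inv \<pi> \<circ> w) \<circ> \<tau>) x" using \<tau>B by simp
    qed
    also have "\<dots> = sign_on A (inv \<pi> \<circ> w) * sign_on A \<tau>"
    proof (rule sign_on_compose[OF bij])
      show "bij_betw \<tau> A A"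
        using \<tau>A permutes_inj_on[OF \<tau>S] by (auto simp: bij_betw_def)
      show "finite A" using AS S by (rule finite_subset)
    qed
    also have "sign_on A \<tau> = -1" unfolding \<tau>_def using ab by (intro sign_on_transpose)
    finally show ?thesis by simp
  qed
  have "sum ?f ?W = (\<Sum>w\<in>?W. - ?f w)"
  proof (rule sum.reindex_bij_witness[of _ "\<lambda>w. \<tau> \<circ> w \<circ> \<tau>" "\<lambda>w. \<tau> \<circ> w \<circ> \<tau>"])
    fix w assume w: "w \<in> ?W"
    show "\<tau> \<circ> w \<circ> \<tau> \<in> ?W" by (rule W[OF w])
    show "\<tau> \<circ> (\<tau> \<circ> w \<circ> \<tau>) \<circ> \<tau> = w" by (simp add: fun_eq_iff \<tau>\<tau>)
    have "cycle_count S (\<tau> \<circ> w \<circ> \<tau>) = cycle_count S w"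
      using cycle_count_conjugate[OF S _ \<tau>S, of w] w by (simp add: inv\<tau>)
    then show "- ?f (\<tau> \<circ> w \<circ> \<tau>) = ?f w" using sgn[OF w] by simp
  next
    fix w assume w: "w \<in> ?W"
    show "\<tau> \<circ> w \<circ> \<tau> \<in> ?W" by (rule W[OF w])
    show "\<tau> \<circ> (\<tau> \<circ> w \<circ> \<tau>) \<circ> \<tau> = w" by (simp add: fun_eq_iff \<tau>\<tau>)
  qed
  also have "\<dots> = - sum ?f ?W" by (rule sum_negf)
  finally have "sum ?f ?W + sum ?f ?W = 0" by (rule iffD1[OF eq_neg_iff_add_eq_0])
  then have "2 * sum ?f ?W = 0" by (simp only: mult_2)
  then show ?thesis by (simp only: mult_eq_0_iff zero_neq_numeral[symmetric] simp_thms)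
qed

section \<open>Factorization of the sum attached to an arc\<close>

lemma sum_permutes_stabilizer:
  assumes "A \<subseteq> S"
  shows "(\<Sum>w | w permutes S \<and> w ` A = A. g w) =
    (\<Sum>u | u permutes A. \<Sum>v | v permutes S - A. g (u \<circ> v))"
proof -
  have "(\<Sum>w | w permutes S \<and> w ` A = A. g w) =
    (\<Sum>(u, v)\<in>{u. u permutes A} \<times> {v. v permutes S - A}. g (u \<circ> v))"
  proof (rule sum.reindex_bij_witness[of _ "\<lambda>(u, v). u \<circ> v"
        "\<lambda>w. (restrict_id w A, restrict_id w (S - A))"])
    fix w assume "w \<in> {w. w permutes S \<and> w ` A = A}"
    then have w: "w permutes S" "w ` A = A" by auto
    have "bij_betw w A A" "bij_betw w (S - A) (S - A)"
      using w permutes_inj_on[OF w(1)] permutes_image[OF w(1)]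
      by (auto simp: bij_betw_def image_set_diff[OF permutes_inj[OF w(1)]])
    then show "(restrict_id w A, restrict_id w (S - A)) \<in> {u. u permutes A} \<times> {v. v permutes S - A}"
      by (auto intro: permutes_restrict_id)
    have "w x \<notin> A" if "x \<notin> A" for x
      using that w(2) permutes_inj[OF w(1)] by (metis inj_image_mem_iff)
    then have "restrict_id w A \<circ> restrict_id w (S - A) = w"
      using permutes_not_in[OF w(1)] assms by (auto simp: fun_eq_iff restrict_id_def)
    then show "(case (restrict_id w A, restrict_id w (S - A)) of (u, v) \<Rightarrow> u \<circ> v) = w"
      "(case (restrict_id w A, restrict_id w (S - A)) of (u, v) \<Rightarrow> g (u \<circ> v)) = g w"
      by simp_all
  next
    fix uv assume "uv \<in> {u. u permutes A} \<times> {v. v permutes S - A}"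
    then obtain u v where uv: "uv = (u, v)" "u permutes A" "v permutes S - A" by auto
    have v: "v x = x" if "x \<in> A" for x using that uv by (intro permutes_not_in[of v]) auto
    have u: "u x = x" if "x \<notin> A" for x using that uv by (intro permutes_not_in[of u]) auto
    have vA: "v x \<notin> A" if "x \<notin> A" for x
      using that permutes_in_image[OF uv(3), of x] permutes_not_in[OF uv(3), of x] by (cases "x \<in> S") auto
    have "u permutes S" "v permutes S" using uv assms by (auto intro: permutes_subset)
    then have "u \<circ> v permutes S" by (intro permutes_compose)
    moreover have "(u \<circ> v) ` A = u ` A" using v by (intro image_cong) auto
    ultimately show "(case uv of (u, v) \<Rightarrow> u \<circ> v) \<in> {w. w permutes S \<and> w ` A = A}"
      using uv permutes_image[OF uv(2)] by simp
    have "restrict_id (u \<circ> v) A = u" "restrict_id (u \<circ> v) (S - A) = v"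
      using u v vA permutes_not_in[OF uv(3)] by (auto simp: fun_eq_iff restrict_id_def)
    then show "(restrict_id (case uv of (u, v) \<Rightarrow> u \<circ> v) A,
        restrict_id (case uv of (u, v) \<Rightarrow> u \<circ> v) (S - A)) = uv"
      using uv by simp
  qed
  then show ?thesis by (simp add: sum.cartesian_product)
qed

text \<open>Up to the constant \<open>(-1) ^ card S\<close>, the sign of \<open>p\<close> is
  absorbed by replacing \<open>x\<close> with \<open>- x\<close>.\<close>

lemma sum_sign_power_cycle_count:
  fixes x :: "'b::comm_ring_1"
  assumes "finite S"
  shows "(\<Sum>p | p permutes S. of_int (sign p) * x ^ cycle_count S p) =
    (-1) ^ card S * pochhammer (- x) (card S)"
proof -
  have "(\<Sum>p | p permutes S. of_int (sign p) * x ^ cycle_count S p) =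
      (\<Sum>p | p permutes S. (-1) ^ card S * (- x) ^ cycle_count S p)"
    using assms by (intro sum.cong)
      (auto simp: sign_conv_cycle_count power_add power_minus[of x] mult_ac)
  then show ?thesis by (simp add: sum_power_cycle_count[OF assms] flip: sum_distrib_left)
qed

lemma transpose_image_exchange:
  assumes "a \<in> A" "b \<notin> A"
  shows "transpose a b ` A = insert b (A - {a})"
  using assms by (auto simp: transpose_def image_iff)

lemma sum_sign_on_exchange:
  fixes q :: "'b::comm_ring_1"
  assumes S: "finite S" and \<pi>: "\<pi> permutes S" and AS: "A \<subseteq> S"
    and ab: "a \<in> A" "b \<in> S" "b \<notin> A" "\<pi> ` A = insert b (A - {a})"
  shows "q * (\<Sum>w | w permutes S \<and> w ` A = \<pi> ` A. q ^ cycle_count S w * of_int (sign_on A (inv \<pi> \<circ> w))) =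
    of_int (sign_on A (inv \<pi> \<circ> transpose a b)) * ((-1) ^ card A * pochhammer (- q) (card A) *
      pochhammer q (card S - card A))"
proof -
  define t where "t = transpose a b"
  have t: "t permutes S" unfolding t_def using ab AS by (intro permutes_swap_id) auto
  have tt: "t (t x) = x" for x unfolding t_def by simp
  have tA: "t ` A = \<pi> ` A" unfolding t_def using ab transpose_image_exchange by metis
  have finA: "finite A" "finite (S - A)" using AS S finite_subset by auto
  define c where "c = sign_on A (inv \<pi> \<circ> t)"
  have *: "q * (q ^ cycle_count S (t \<circ> (u \<circ> v)) * of_int (sign_on A (inv \<pi> \<circ> (t \<circ> (u \<circ> v))))) =
      of_int c * ((of_int (sign u) * q ^ cycle_count A u) * q ^ cycle_count (S - A) v)"
    if uv: "u permutes A" "v permutes S - A" for u v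
  proof -
    have v: "v x = x" if "x \<in> A" for x using that uv by (intro permutes_not_in[of v]) auto
    have uvS: "u \<circ> v permutes S"
      using uv AS by (intro permutes_compose) (auto intro: permutes_subset)
    have "orbit (u \<circ> v) a \<subseteq> A"
      using ab uv v by (intro orbit_subsetI_invariant) (auto simp: permutes_in_image)
    then have "Suc (cycle_count S (t \<circ> (u \<circ> v))) = cycle_count S (u \<circ> v)"
      unfolding t_def using S uvS ab AS by (intro cycle_count_transpose_comp) auto
    also have "\<dots> = cycle_count (A \<union> (S - A)) (u \<circ> v)" using AS by (simp add: Un_absorb1)
    also have "\<dots> = cycle_count A u + cycle_count (S - A) v"
      using finA uv by (intro cycle_count_Un) auto
    finally have cc: "q * q ^ cycle_count S (t \<circ> (u \<circ> v)) =
        q ^ cycle_count A u * q ^ cycle_count (S - A) v"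
      by (metis power_Suc power_add)
    have "sign_on A (inv \<pi> \<circ> (t \<circ> (u \<circ> v))) = sign_on A ((inv \<pi> \<circ> t) \<circ> u)"
      using v by (intro sign_on_cong) auto
    also have "\<dots> = c * sign_on A u"
      unfolding c_def using permutes_imp_bij[OF uv(1)] finA
      by (intro sign_on_compose bij_betw_inv_comp[OF \<pi> t tA])
    also have "sign_on A u = sign u" using uv by (intro sign_on_permutes) auto
    finally have sg: "sign_on A (inv \<pi> \<circ> (t \<circ> (u \<circ> v))) = c * sign u" .
    show ?thesis unfolding sg mult.assoc[symmetric] cc by (simp add: mult_ac)
  qed
  have "q * (\<Sum>w | w permutes S \<and> w ` A = \<pi> ` A. q ^ cycle_count S w * of_int (sign_on A (inv \<pi> \<circ> w))) =
    (\<Sum>w | w permutes S \<and> w ` A = \<pi> ` A. q * (q ^ cycle_count S w * of_int (sign_on A (inv \<pi> \<circ> w))))"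
    by (rule sum_distrib_left)
  also have "\<dots> = (\<Sum>w | w permutes S \<and> w ` A = A.
      q * (q ^ cycle_count S (t \<circ> w) * of_int (sign_on A (inv \<pi> \<circ> (t \<circ> w)))))"
  proof (rule sum.reindex_bij_witness[of _ "\<lambda>w. t \<circ> w" "\<lambda>w. t \<circ> w"])
    fix w assume w: "w \<in> {w. w permutes S \<and> w ` A = \<pi> ` A}"
    have "(t \<circ> w) ` A = t ` w ` A" by (simp only: image_comp)
    also have "w ` A = \<pi> ` A" using w by simp
    also have "t ` \<pi> ` A = A" by (simp add: tA[symmetric] image_image tt)
    finally show "t \<circ> w \<in> {w. w permutes S \<and> w ` A = A}"
      using w t by (auto intro: permutes_compose)
    have eq: "t \<circ> (t \<circ> w) = w" by (simp add: fun_eq_iff tt)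
    then show "t \<circ> (t \<circ> w) = w" .
    show "q * (q ^ cycle_count S (t \<circ> (t \<circ> w)) * of_int (sign_on A (inv \<pi> \<circ> (t \<circ> (t \<circ> w))))) =
      q * (q ^ cycle_count S w * of_int (sign_on A (inv \<pi> \<circ> w)))"
      unfolding eq ..
  next
    fix w assume w: "w \<in> {w. w permutes S \<and> w ` A = A}"
    have "(t \<circ> w) ` A = t ` w ` A" by (simp only: image_comp)
    then have "(t \<circ> w) ` A = \<pi> ` A" using w tA by simp
    then show "t \<circ> w \<in> {w. w permutes S \<and> w ` A = \<pi> ` A}"
      using w t by (auto intro: permutes_compose)
    show "t \<circ> (t \<circ> w) = w" by (simp add: fun_eq_iff tt)
  qed
  also have "\<dots> = (\<Sum>u | u permutes A. \<Sum>v | v permutes S - A.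
      of_int c * ((of_int (sign u) * q ^ cycle_count A u) * q ^ cycle_count (S - A) v))"
    unfolding sum_permutes_stabilizer[OF AS] by (intro sum.cong refl *) auto
  also have "\<dots> = of_int c * ((\<Sum>u | u permutes A. of_int (sign u) * q ^ cycle_count A u) *
      (\<Sum>v | v permutes S - A. q ^ cycle_count (S - A) v))"
    by (subst sum_product) (simp only: sum_distrib_left)
  also have "\<dots> = of_int c * ((-1) ^ card A * pochhammer (- q) (card A) * pochhammer q (card S - card A))"
    using finA AS by (simp add: sum_sign_power_cycle_count sum_power_cycle_count card_Diff_subset)
  finally show ?thesis unfolding c_def t_def .
qed

subsection \<open>The cycle enumerator of the product of two long cycles\<close>

text \<open>A set that is not an interval has a gap \<open>m\<close>. Its minimum and its least
  element above \<open>m\<close> both start a run. Since 0 is excluded, \<open>Min J - 1\<close> is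
  a genuine predecessor.\<close>

lemma interval_or_two_starts:
  fixes J :: "nat set"
  assumes "finite J" "J \<noteq> {}" "0 \<notin> J"
  shows "(\<exists>i j. i < j \<and> J = {i..<j}) \<or>
    (\<exists>a\<in>J. \<exists>b\<in>J. a \<noteq> b \<and> a - 1 \<notin> J \<and> b - 1 \<notin> J)"
proof (cases "J = {Min J..<Suc (Max J)}")
  case True
  moreover have "Min J < Suc (Max J)" using assms by (simp add: less_Suc_eq_le)
  ultimately show ?thesis by blast
next
  case False
  moreover have "J \<subseteq> {Min J..<Suc (Max J)}" using assms by (auto simp: less_Suc_eq_le)
  ultimately obtain m where m: "Min J \<le> m" "m \<le> Max J" "m \<notin> J" by force
  have Min: "Min J \<in> J" using assms by simp
  then have "Min J \<noteq> 0" using assms(3) by metis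
  then have Min': "Min J - 1 \<notin> J" using Min_le[OF assms(1), of "Min J - 1"] by linarith
  define b where "b = (LEAST b. b \<in> J \<and> m < b)"
  have ex: "Max J \<in> J \<and> m < Max J"
    using m Max_in[OF assms(1,2)] by (metis le_neq_implies_less)
  have b: "b \<in> J \<and> m < b" unfolding b_def using ex by (rule LeastI)
  have "b - 1 \<notin> J"
  proof
    assume "b - 1 \<in> J"
    moreover from this have "m < b - 1" using b m(3) by (cases "m = b - 1") auto
    ultimately have "b \<le> b - 1" unfolding b_def by (intro Least_le) auto
    then show False using b by auto
  qed
  moreover have "Min J \<noteq> b" using b m(1) by auto
  ultimately show ?thesis using b Min Min' by blast
qed

lemma sign_on_empty [simp]: "sign_on {} f = 1"
proof -
  have "restrict_id f {} = id" by (auto simp: fun_eq_iff)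
  then show ?thesis by (simp add: sign_on_def)
qed

lemma sum_cyclic_eq_sum_sign_on:
  fixes q :: "'b::comm_ring_1"
  assumes S: "finite S" and \<pi>: "\<pi> permutes S" and x: "x \<in> S"
  shows "(\<Sum>\<zeta> | \<zeta> permutes S \<and> cycle_count S \<zeta> = 1. q ^ cycle_count S (\<pi> \<circ> \<zeta>)) =
    (\<Sum>A\<in>Pow (S - {x}). (-1) ^ card A *
      (\<Sum>w | w permutes S \<and> w ` A = \<pi> ` A. q ^ cycle_count S w * of_int (sign_on A (inv \<pi> \<circ> w))))"
proof -
  note inv = permutes_inverses[OF \<pi>]
  have fin: "finite {w. w permutes S}" using S by (rule finite_permutations)
  have stab: "(inv \<pi> \<circ> w) ` A = A \<longleftrightarrow> w ` A = \<pi> ` A" for w A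
  proof -
    have *: "(inv \<pi> \<circ> w) ` A = inv \<pi> ` w ` A" by (simp only: image_comp)
    have "\<pi> ` inv \<pi> ` B = B" "inv \<pi> ` \<pi> ` B = B" for B by (simp_all add: image_image inv)
    then show ?thesis unfolding * by metis
  qed
  have "(\<Sum>\<zeta> | \<zeta> permutes S \<and> cycle_count S \<zeta> = 1. q ^ cycle_count S (\<pi> \<circ> \<zeta>)) =
    (\<Sum>w | w permutes S \<and> cycle_count S (inv \<pi> \<circ> w) = 1. q ^ cycle_count S w)"
  proof (rule sum.reindex_bij_witness[of _ "\<lambda>w. inv \<pi> \<circ> w" "\<lambda>\<zeta>. \<pi> \<circ> \<zeta>"])
    fix \<zeta> assume "\<zeta> \<in> {\<zeta>. \<zeta> permutes S \<and> cycle_count S \<zeta> = 1}"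
    moreover have eq: "inv \<pi> \<circ> (\<pi> \<circ> \<zeta>) = \<zeta>" by (simp add: fun_eq_iff inv)
    ultimately show "\<pi> \<circ> \<zeta> \<in> {w. w permutes S \<and> cycle_count S (inv \<pi> \<circ> w) = 1}"
      using \<pi> by (auto simp only: mem_Collect_eq intro: permutes_compose)
    show "inv \<pi> \<circ> (\<pi> \<circ> \<zeta>) = \<zeta>" by (rule eq)
  next
    fix w assume "w \<in> {w. w permutes S \<and> cycle_count S (inv \<pi> \<circ> w) = 1}"
    then show "inv \<pi> \<circ> w \<in> {\<zeta>. \<zeta> permutes S \<and> cycle_count S \<zeta> = 1}"
      using permutes_inv[OF \<pi>] by (auto simp only: mem_Collect_eq intro: permutes_compose)
    show "\<pi> \<circ> (inv \<pi> \<circ> w) = w" by (simp add: fun_eq_iff inv)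
  qed simp
  also have "\<dots> = (\<Sum>w | w permutes S. if cycle_count S (inv \<pi> \<circ> w) = 1 then q ^ cycle_count S w else 0)"
    using sum.inter_filter[OF fin, of "\<lambda>w. q ^ cycle_count S w" "\<lambda>w. cycle_count S (inv \<pi> \<circ> w) = 1"]
    by simp
  also have "\<dots> = (\<Sum>w | w permutes S. \<Sum>A\<in>{A \<in> Pow (S - {x}). w ` A = \<pi> ` A}.
      (-1) ^ card A * (q ^ cycle_count S w * of_int (sign_on A (inv \<pi> \<circ> w))))"
  proof (rule sum.cong[OF refl])
    fix w assume "w \<in> {w. w permutes S}"
    then have "inv \<pi> \<circ> w permutes S" using permutes_inv[OF \<pi>] by (auto intro: permutes_compose)
    note sum_sign_on_invariant_sets[OF S this x]
    moreover have "(if cycle_count S (inv \<pi> \<circ> w) = 1 then q ^ cycle_count S w else 0) =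
        q ^ cycle_count S w * of_int (if cycle_count S (inv \<pi> \<circ> w) = 1 then 1 else 0)"
      by simp
    ultimately have "(if cycle_count S (inv \<pi> \<circ> w) = 1 then q ^ cycle_count S w else 0) =
      q ^ cycle_count S w * of_int (\<Sum>A | A \<subseteq> S - {x} \<and> (inv \<pi> \<circ> w) ` A = A.
        (-1) ^ card A * sign_on A (inv \<pi> \<circ> w))"
      by (simp only:)
    also have "\<dots> = (\<Sum>A\<in>{A \<in> Pow (S - {x}). w ` A = \<pi> ` A}.
      (-1) ^ card A * (q ^ cycle_count S w * of_int (sign_on A (inv \<pi> \<circ> w))))"
      unfolding stab of_int_sum sum_distrib_left by (intro sum.cong) (auto simp: mult_ac)
    finally show "(if cycle_count S (inv \<pi> \<circ> w) = 1 then q ^ cycle_count S w else 0) =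
      (\<Sum>A\<in>{A \<in> Pow (S - {x}). w ` A = \<pi> ` A}.
        (-1) ^ card A * (q ^ cycle_count S w * of_int (sign_on A (inv \<pi> \<circ> w))))" .
  qed
  also have "\<dots> = (\<Sum>A\<in>Pow (S - {x}). \<Sum>w\<in>{w \<in> {w. w permutes S}. w ` A = \<pi> ` A}.
      (-1) ^ card A * (q ^ cycle_count S w * of_int (sign_on A (inv \<pi> \<circ> w))))"
    using S fin by (intro sum.swap_restrict) auto
  finally show ?thesis by (simp add: sum_distrib_left)
qed

text \<open>Numbering the cycle from \<open>x\<close> turns subsets of \<open>S - {x}\<close> into
  sets of exponents between 1 and n - 1. The pair (i, j) stands for the arc with exponents
  \<open>{i..<j}\<close>; its end is exclusive, so j = n is allowed. The term
  \<open>q * pochhammer q n\<close> comes from the empty set.\<close>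

lemma sum_cyclic_eq_sum_arcs:
  fixes q :: "'b::{idom,ring_char_0}"
  assumes S: "finite S" and \<pi>: "\<pi> permutes S" and cyc: "cyclic_on \<pi> S"
  defines "n \<equiv> card S"
  shows "q * (\<Sum>\<zeta> | \<zeta> permutes S \<and> cycle_count S \<zeta> = 1. q ^ cycle_count S (\<pi> \<circ> \<zeta>)) =
    q * pochhammer q n -
    (\<Sum>i=1..<n. \<Sum>j\<in>{i<..n}. (-1) ^ (j - i) * pochhammer (- q) (j - i) * pochhammer q (n - (j - i)))"
proof -
  obtain x where x: "x \<in> S" "S = orbit \<pi> x" using cyc by (auto simp: cyclic_on_def)
  define e where "e = (\<lambda>m. (\<pi> ^^ m) x)"
  \<comment> \<open>\<open>N\<close> is the first positive return time to \<open>x\<close>, hence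
    the length of the cycle.\<close>
  define N where "N = funpow_dist1 \<pi> x x"
  have x_orbit: "x \<in> orbit \<pi> x" using x by simp
  have inj: "inj_on e {0..<N}" unfolding e_def N_def by (rule inj_on_funpow_dist1[OF x_orbit])
  have S_eq: "S = e ` {0..<N}"
    unfolding e_def N_def using orbit_conv_funpow_dist1[OF x_orbit] x by simp
  have "n = N" unfolding n_def S_eq using card_image[OF inj] by simp
  have "N > 0" unfolding N_def by simp
  have eN: "e N = x" unfolding e_def N_def by (rule funpow_dist1_prop[OF x_orbit])
  have e0: "e 0 = x" by (simp add: e_def)
  have eSuc: "\<pi> (e m) = e (Suc m)" for m by (simp add: e_def)
  have inv_e: "inv \<pi> (e (Suc m)) = e m" for m
    using eSuc[of m] permutes_inverses(2)[OF \<pi>] by metis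
  have Sx: "S - {x} = e ` {1..<N}"
  proof -
    have "{0..<N} = insert 0 {1..<N}" using \<open>N > 0\<close> by auto
    then have "S = insert x (e ` {1..<N})" unfolding S_eq using e0 by simp
    moreover have "x \<notin> e ` {1..<N}"
      using inj \<open>N > 0\<close> e0 unfolding inj_on_def by force
    ultimately show ?thesis by auto
  qed
  define T where "T = (\<lambda>A. (-1) ^ card A * (\<Sum>w | w permutes S \<and> w ` A = \<pi> ` A.
    q ^ cycle_count S w * of_int (sign_on A (inv \<pi> \<circ> w))))"
  define I where "I = (SIGMA i:{1..<N}. {i<..N})"
  define arc where "arc = (\<lambda>(i, j). e ` {i..<j})"

  \<comment> \<open>Injectivity of \<open>e\<close> extended to the exponent \<open>N\<close>: there
    the walk is back at \<open>e 0\<close>, which \<open>1 \<le> a\<close> rules out.\<close>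
  have e_eq: "a = Suc m" if "1 \<le> a" "a < N" "m < N" "e a = e (Suc m)" for a m
  proof (cases "Suc m < N")
    case True
    then show ?thesis using that inj by (auto simp: inj_on_def)
  next
    case False
    then have "Suc m = N" using that by simp
    then have "e a = e 0" using that eN e0 by simp
    then have "a = 0" using that \<open>N > 0\<close> inj unfolding inj_on_def by simp
    then show ?thesis using that by simp
  qed

  have T_empty: "T {} = pochhammer q N"
    using sum_power_cycle_count[OF S, of q] \<open>n = N\<close> by (simp add: T_def n_def)

  have T_arc: "q * T (arc (i, j)) =
      - ((-1) ^ (j - i) * pochhammer (- q) (j - i) * pochhammer q (N - (j - i)))"
    if ij: "1 \<le> i" "i < j" "j \<le> N" for i j
  proof -
    define A where "A = e ` {i..<j}"
    define g where "g = inv \<pi> \<circ> transpose (e i) (e j)"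
    have injA: "inj_on e {i..<j}" using inj ij by (auto intro: inj_on_subset)
    have AS: "A \<subseteq> S" unfolding A_def S_eq using ij by auto
    then have finA: "finite A" using S finite_subset by auto
    have cardA: "card A = j - i" unfolding A_def using card_image[OF injA] by simp
    have ejS: "e j \<in> S"
      using ij eN x(1) unfolding S_eq by (cases "j = N") (auto simp: S_eq)
    have ejA: "e j \<notin> A"
    proof
      assume "e j \<in> A"
      then obtain m where m: "i \<le> m" "m < j" "e j = e m" unfolding A_def by auto
      then have "m = Suc (j - 1)" using ij by (intro e_eq) auto
      then show False using m by simp
    qed
    have eiA: "e i \<in> A" unfolding A_def using ij by auto
    have neq: "e m \<noteq> e i" if "i < m" "m < j" for m
      using inj_onD[OF injA, of m i] that by auto
    have "\<pi> ` A = e ` {Suc i..<Suc j}"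
      unfolding A_def by (simp add: image_image eSuc flip: image_Suc_atLeastLessThan)
    also have "{Suc i..<Suc j} = insert j {Suc i..<j}" using ij by auto
    also have "e ` \<dots> = insert (e j) (A - {e i})"
    proof -
      have "{i..<j} = insert i {Suc i..<j}" using ij by auto
      then have "A = insert (e i) (e ` {Suc i..<j})" unfolding A_def by simp
      moreover have "e i \<notin> e ` {Suc i..<j}" using neq by (auto simp: image_iff) (metis Suc_le_lessD)
      ultimately show ?thesis by auto
    qed
    finally have \<pi>A: "\<pi> ` A = insert (e j) (A - {e i})" .
    have g_start: "g (e i) = e (j - 1)"
      using ij inv_e[of "j - 1"] by (simp add: g_def)
    have g_step: "g (e (Suc m)) = e m" if "i \<le> m" "Suc m < j" for m
    proof -
      have "e (Suc m) \<in> A" using that unfolding A_def by auto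
      then have "e (Suc m) \<noteq> e j" using ejA by auto
      moreover have "e (Suc m) \<noteq> e i" using that by (intro neq) auto
      ultimately show ?thesis by (simp add: g_def inv_e)
    qed
    have bij: "bij_betw g A A"
      unfolding g_def
    proof (rule bij_betw_inv_comp[OF \<pi>])
      show "transpose (e i) (e j) permutes S" using ejS eiA AS by (intro permutes_swap_id) auto
      show "transpose (e i) (e j) ` A = \<pi> ` A"
        unfolding \<pi>A using eiA ejA by (rule transpose_image_exchange)
    qed
    then have gA: "g ` A = A" "inj_on g A" by (auto simp: bij_betw_def)
    \<comment> \<open>\<open>g\<close> sends the first point of the arc to the last and then runs
      backwards. So \<open>A\<close> is a single cycle of \<open>g\<close>, which makes the signed
      weight -1.\<close>
    have reach: "e (j - Suc d) \<in> orbit g (e i)" if "d < j - i" for d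
      using that
    proof (induction d)
      case 0
      then show ?case using g_start orbit.base[of g "e i"] by simp
    next
      case (Suc d)
      then have "g (e (j - Suc d)) \<in> orbit g (e i)" by (intro orbit.step) auto
      moreover have "g (e (Suc (j - Suc (Suc d)))) = e (j - Suc (Suc d))"
        using Suc.prems by (intro g_step) auto
      moreover have "Suc (j - Suc (Suc d)) = j - Suc d" using Suc.prems by auto
      ultimately show ?case by simp
    qed
    have "A \<subseteq> orbit g (e i)"
    proof
      fix y assume "y \<in> A"
      then obtain m where m: "i \<le> m" "m < j" "y = e m" unfolding A_def by auto
      then show "y \<in> orbit g (e i)" using reach[of "j - Suc m"] by auto
    qed
    moreover have "orbit g (e i) \<subseteq> A" using gA eiA by (intro orbit_subsetI_invariant) auto
    ultimately have "cyclic_on g A" using eiA by (auto simp: cyclic_on_def)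
    then have "orbit g ` A = {A}" using eiA orbit_cyclic_eq3[of g A] by auto
    then have sgn: "(-1) ^ card A * sign_on A g = -1"
      using sign_on_conv_card_orbits[OF finA gA(2,1)] by simp
    have "q * T A = (-1) ^ card A * (of_int (sign_on A g) *
        ((-1) ^ card A * pochhammer (- q) (card A) * pochhammer q (card S - card A)))"
      using sum_sign_on_exchange[OF S \<pi> AS eiA ejS ejA \<pi>A, of q]
      unfolding T_def g_def by (simp only: mult.left_commute[of q])
    also have "\<dots> = of_int ((-1) ^ card A * sign_on A g) *
        ((-1) ^ card A * pochhammer (- q) (card A) * pochhammer q (card S - card A))"
      by (simp add: mult_ac)
    finally show ?thesis
      unfolding sgn using cardA \<open>n = N\<close> by (simp add: arc_def A_def n_def)
  qed

  have zero: "T A = 0" if A: "A \<in> Pow (S - {x})" "A \<noteq> {}" "A \<notin> arc ` I" for A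
  proof -
    obtain J where J: "J \<subseteq> {1..<N}" "A = e ` J"
      using A(1) unfolding Sx by (auto simp: subset_image_iff)
    have "finite J" "J \<noteq> {}" "0 \<notin> J" using J A(2) finite_subset by auto
    then consider i j where "i < j" "J = {i..<j}"
      | a b where "a \<in> J" "b \<in> J" "a \<noteq> b" "a - 1 \<notin> J" "b - 1 \<notin> J"
      using interval_or_two_starts[of J] by blast
    then show ?thesis
    proof cases
      case 1
      then have "i \<in> J" "j - 1 \<in> J" by auto
      then have "i \<in> {1..<N}" "j - 1 \<in> {1..<N}" using J(1) by blast+
      then have "(i, j) \<in> I" using 1(1) unfolding I_def by auto
      then have "arc (i, j) \<in> arc ` I" by (rule imageI)
      then show ?thesis using A(3) 1 J by (simp add: arc_def)
    next
      case 2
      \<comment> \<open>The predecessor of the start of a run lies outside \<open>A\<close>; two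
        starts are thus the two points needed for \<open>sum_sign_on_eq_0\<close>.\<close>
      have start: "e c \<notin> \<pi> ` A" if "c \<in> J" "c - 1 \<notin> J" for c
      proof
        assume "e c \<in> \<pi> ` A"
        then obtain m where m: "m \<in> J" "e c = e (Suc m)" using J eSuc by auto
        then have "c = Suc m" using J that by (intro e_eq) (auto simp: subset_iff)
        then show False using m that by simp
      qed
      have ne: "e a \<noteq> e b"
        using 2 J(1) inj unfolding inj_on_def by (metis atLeastLessThan_iff le0 subsetD)
      have mem: "A \<subseteq> S" "e a \<in> A" "e b \<in> A" using A(1) 2 J by auto
      show ?thesis
        using sum_sign_on_eq_0[OF S \<pi> mem ne start[OF 2(1,4)] start[OF 2(2,5)], of q]
        by (simp only: T_def mult_zero_right)
    qed
  qed

  have arc_inj: "inj_on arc I"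
  proof (rule inj_onI)
    fix a b assume "a \<in> I" "b \<in> I" "arc a = arc b"
    then obtain i j i' j' where *: "a = (i, j)" "b = (i', j')" "1 \<le> i" "i < j" "j \<le> N"
      "1 \<le> i'" "i' < j'" "j' \<le> N" "e ` {i..<j} = e ` {i'..<j'}"
      unfolding I_def arc_def by auto
    then have "{i..<j} = {i'..<j'}"
      using inj_on_image_eq_iff[OF inj, of "{i..<j}" "{i'..<j'}"] by auto
    then show "a = b" using * by (auto simp: atLeastLessThan_eq_iff)
  qed
  have arc_sub: "arc ` I \<subseteq> Pow (S - {x})"
    unfolding I_def arc_def Sx by (auto intro!: imageI)
  have arc_ne: "{} \<notin> arc ` I" unfolding I_def arc_def by auto
  have finI: "finite I" unfolding I_def by auto
  have "(\<Sum>\<zeta> | \<zeta> permutes S \<and> cycle_count S \<zeta> = 1. q ^ cycle_count S (\<pi> \<circ> \<zeta>)) =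
      (\<Sum>A\<in>Pow (S - {x}). T A)"
    unfolding T_def using S \<pi> x(1) by (rule sum_cyclic_eq_sum_sign_on)
  also have "\<dots> = (\<Sum>A\<in>insert {} (arc ` I). T A)"
    using S zero arc_sub by (intro sum.mono_neutral_right) auto
  also have "\<dots> = pochhammer q N + (\<Sum>ij\<in>I. T (arc ij))"
    using finI arc_ne arc_inj by (simp add: sum.reindex T_empty)
  finally have "q * (\<Sum>\<zeta> | \<zeta> permutes S \<and> cycle_count S \<zeta> = 1. q ^ cycle_count S (\<pi> \<circ> \<zeta>)) =
      q * pochhammer q N + (\<Sum>ij\<in>I. q * T (arc ij))"
    by (simp add: distrib_left sum_distrib_left)
  also have "(\<Sum>ij\<in>I. q * T (arc ij)) = (\<Sum>(i, j)\<in>I.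
      - ((-1) ^ (j - i) * pochhammer (- q) (j - i) * pochhammer q (N - (j - i))))"
    using T_arc by (intro sum.cong) (auto simp: I_def)
  also have "\<dots> = - (\<Sum>i=1..<N. \<Sum>j\<in>{i<..N}.
      (-1) ^ (j - i) * pochhammer (- q) (j - i) * pochhammer q (N - (j - i)))"
    unfolding I_def by (subst sum.Sigma[symmetric]) (auto simp: sum_negf)
  finally show ?thesis unfolding \<open>n = N\<close> by (simp only: diff_conv_add_uminus)
qed

section \<open>Telescoping of the arc contributions\<close>

lemma pochhammer_diff:
  fixes x :: "'b::comm_ring_1"
  shows "pochhammer x (Suc m) - pochhammer (x - 1) (Suc m) = of_nat (Suc m) * pochhammer x m"
  \<comment> \<open>Both sides share \<open>pochhammer x m\<close>; the remaining factors x + m and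
    x - 1 differ by m + 1.\<close>
  using pochhammer_Suc[of x m] pochhammer_rec[of "x - 1" m] by (simp add: algebra_simps)

text \<open>The first two factors form the falling factorial q (q-1) ... (q-k+1), and the third is q
  times (q+1) ... (q+n-k-1). With that q pulled out, n - 1 consecutive factors remain.\<close>

lemma pochhammer_arc:
  fixes q :: "'b::comm_ring_1"
  assumes "k < n"
  shows "(-1) ^ k * pochhammer (- q) k * pochhammer q (n - k) =
    q * pochhammer (q - of_nat k + 1) (n - 1)"
proof -
  obtain m where m: "n = Suc (k + m)" using assms less_iff_Suc_add by auto
  have "pochhammer (q - of_nat k + 1) (k + m) = pochhammer (q - of_nat k + 1) k * pochhammer (q + 1) m"
    by (simp add: pochhammer_product' algebra_simps)
  moreover have "pochhammer q (n - k) = q * pochhammer (q + 1) m"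
    using m by (simp add: pochhammer_rec)
  ultimately show ?thesis using m by (simp add: pochhammer_minus' mult_ac)
qed

text \<open>Multiplied by n, each summand is a difference of consecutive values of \<open>d\<close>,
  so the sum over j collapses. The sum over k that remains telescopes only after another factor n +
  1.\<close>

lemma sum_pochhammer_arcs:
  fixes q :: "'b::comm_ring_1"
  assumes n: "n \<ge> 1"
  shows "of_nat n * (\<Sum>i=1..<n. \<Sum>j\<in>{i<..n}. pochhammer (q - of_nat (j - i) + 1) (n - 1)) =
    of_nat n * pochhammer q n - (\<Sum>k<n. pochhammer (q - of_nat k) n)"
proof -
  define d where "d = (\<lambda>k. pochhammer (q - of_nat k) n)"
  have diff: "of_nat n * pochhammer (q - of_nat (Suc k) + 1) (n - 1) = d k - d (Suc k)" for k
    using pochhammer_diff[of "q - of_nat k" "n - 1"] n by (simp add: d_def algebra_simps)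
  have inner: "of_nat n * (\<Sum>j\<in>{i<..n}. pochhammer (q - of_nat (j - i) + 1) (n - 1)) = d 0 - d (n - i)"
    if "i < n" for i
  proof -
    have "(\<Sum>j\<in>{i<..n}. pochhammer (q - of_nat (j - i) + 1) (n - 1)) =
        (\<Sum>k<n - i. pochhammer (q - of_nat (Suc k) + 1) (n - 1))"
      by (rule sum.reindex_bij_witness[of _ "\<lambda>k. i + Suc k" "\<lambda>j. j - Suc i"])
         (use that in \<open>auto simp: Suc_diff_Suc\<close>)
    then show ?thesis
      by (simp only: sum_distrib_left diff sum_lessThan_telescope')
  qed
  have "of_nat n * (\<Sum>i=1..<n. \<Sum>j\<in>{i<..n}. pochhammer (q - of_nat (j - i) + 1) (n - 1)) =
      (\<Sum>i=1..<n. d 0 - d (n - i))"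
    unfolding sum_distrib_left[of "of_nat n" _ "{1..<n}"] using inner by (intro sum.cong) auto
  also have "\<dots> = (\<Sum>k=1..<n. d 0 - d k)"
    by (rule sum.reindex_bij_witness[of _ "\<lambda>k. n - k" "\<lambda>k. n - k"]) auto
  \<comment> \<open>The added term for k = 0 vanishes.\<close>
  also have "\<dots> = (\<Sum>k<n. d 0 - d k)"
    by (rule sum.mono_neutral_left) (use not_less_eq_eq in auto)
  also have "\<dots> = of_nat n * d 0 - (\<Sum>k<n. d k)" by (simp add: sum_subtractf)
  finally show ?thesis by (simp add: d_def)
qed

text \<open>The second product is the falling one, q (q-1) ... (q-n). The assumption
  \<open>q \<noteq> 0\<close> cancels the factor \<open>q\<close> that the arc formula
  carries.\<close>

lemma sum_cyclic_closed_form: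
  fixes q :: "'b::{idom,ring_char_0}"
  assumes S: "finite S" and \<pi>: "\<pi> permutes S" and cyc: "cyclic_on \<pi> S" and "q \<noteq> 0"
  defines "n \<equiv> card S"
  shows "of_nat n * of_nat (Suc n) *
      (\<Sum>\<zeta> | \<zeta> permutes S \<and> cycle_count S \<zeta> = 1. q ^ cycle_count S (\<pi> \<circ> \<zeta>)) =
    pochhammer q (Suc n) - pochhammer (q - of_nat n) (Suc n)"
proof -
  let ?P = "\<Sum>\<zeta> | \<zeta> permutes S \<and> cycle_count S \<zeta> = 1. q ^ cycle_count S (\<pi> \<circ> \<zeta>)"
  let ?R = "\<Sum>i=1..<n. \<Sum>j\<in>{i<..n}. pochhammer (q - of_nat (j - i) + 1) (n - 1)"
  have "S \<noteq> {}" using cyc by (auto simp: cyclic_on_def)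
  then have n: "n \<ge> 1" using S by (simp add: n_def Suc_le_eq card_gt_0_iff)
  have "q * ?P = q * pochhammer q n -
    (\<Sum>i=1..<n. \<Sum>j\<in>{i<..n}. (-1) ^ (j - i) * pochhammer (- q) (j - i) * pochhammer q (n - (j - i)))"
    unfolding n_def by (rule sum_cyclic_eq_sum_arcs[OF S \<pi> cyc])
  also have "(\<Sum>i=1..<n. \<Sum>j\<in>{i<..n}. (-1) ^ (j - i) * pochhammer (- q) (j - i) * pochhammer q (n - (j - i))) =
      (\<Sum>i=1..<n. \<Sum>j\<in>{i<..n}. q * pochhammer (q - of_nat (j - i) + 1) (n - 1))"
    by (intro sum.cong refl pochhammer_arc) auto
  also have "\<dots> = q * ?R" by (simp add: sum_distrib_left)
  finally have "q * ?P = q * (pochhammer q n - ?R)" by (simp only: right_diff_distrib)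
  then have P: "?P = pochhammer q n - ?R" using \<open>q \<noteq> 0\<close> by (simp only: mult_cancel_left simp_thms)
  have nP: "of_nat n * ?P = (\<Sum>k<n. pochhammer (q - of_nat k) n)"
    unfolding P right_diff_distrib sum_pochhammer_arcs[OF n] by simp
  have "of_nat n * of_nat (Suc n) * ?P = of_nat (Suc n) * (\<Sum>k<n. pochhammer (q - of_nat k) n)"
    unfolding nP[symmetric] by (simp only: mult_ac)
  also have "\<dots> = (\<Sum>k<n. of_nat (Suc n) * pochhammer (q - of_nat k) n)"
    by (rule sum_distrib_left)
  also have "\<dots> = (\<Sum>k<n. pochhammer (q - of_nat k) (Suc n) - pochhammer (q - of_nat (Suc k)) (Suc n))"
  proof (rule sum.cong[OF refl])
    fix k
    have "q - of_nat (Suc k) = q - of_nat k - 1" by simp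
    then show "of_nat (Suc n) * pochhammer (q - of_nat k) n =
        pochhammer (q - of_nat k) (Suc n) - pochhammer (q - of_nat (Suc k)) (Suc n)"
      using pochhammer_diff[of "q - of_nat k" n] by (simp only:)
  qed
  also have "\<dots> = pochhammer q (Suc n) - pochhammer (q - of_nat n) (Suc n)"
    by (subst sum_lessThan_telescope') simp
  finally show ?thesis .
qed

section \<open>Zeros of the difference of the two products\<close>

lemma norm_diff_less_norm_add:
  fixes q :: complex
  assumes "Re q > 0" "i > 0"
  shows "norm (q - of_nat i) < norm (q + of_nat i)"
proof -
  have "Re q * real i > 0" using assms by simp
  then have "(norm (q - of_nat i))\<^sup>2 < (norm (q + of_nat i))\<^sup>2"
    unfolding cmod_power2 by (simp add: power2_eq_square algebra_simps)
  then show ?thesis by (rule power_less_imp_less_base) simp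
qed

text \<open>The products are compared factor by factor. The factors for i = 0 agree, so strictness
  comes from i = 1, which occurs because \<open>n \<ge> 1\<close>.\<close>

lemma norm_pochhammer_less:
  fixes q :: complex
  assumes "Re q > 0" "n \<ge> 1"
  shows "norm (pochhammer (q - of_nat n) (Suc n)) < norm (pochhammer q (Suc n))"
proof -
  have "pochhammer (q - of_nat n) (Suc n) = (\<Prod>i=0..n. q - of_nat i)"
    unfolding pochhammer_Suc_prod_rev by (intro prod.cong) (auto simp: of_nat_diff)
  also have "norm \<dots> = (\<Prod>i=0..n. norm (q - of_nat i))" by (simp add: prod_norm)
  also have "\<dots> < (\<Prod>i=0..n. norm (q + of_nat i))"
  proof (rule prod_mono_strict)
    show "norm (q - of_nat 1) < norm (q + of_nat 1)"
      using assms by (intro norm_diff_less_norm_add) auto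
    show "0 \<le> norm (q - of_nat i) \<and> norm (q - of_nat i) \<le> norm (q + of_nat i)" for i
      using norm_diff_less_norm_add[OF assms(1), of i] by (cases "i = 0") auto
    show "0 < norm (q + of_nat i)" for i
    proof -
      have "Re (q + of_nat i) > 0" using assms by simp
      then show ?thesis by (metis less_irrefl zero_complex.sel(1) zero_less_norm_iff)
    qed
  qed (use assms in auto)
  also have "\<dots> = norm (pochhammer q (Suc n))" by (simp add: pochhammer_Suc_prod prod_norm)
  finally show ?thesis .
qed

lemma Re_eq_0_of_pochhammer_eq:
  fixes q :: complex
  assumes "pochhammer q (Suc n) = pochhammer (q - of_nat n) (Suc n)" "n \<ge> 1"
  shows "Re q = 0"
proof (rule ccontr)
  assume "Re q \<noteq> 0"
  then consider "Re q > 0" | "Re (- q) > 0" by fastforce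
  then show False
  proof cases
    case 1
    then show ?thesis using norm_pochhammer_less[of q n] assms by simp
  next
    case 2
    \<comment> \<open>Replacing q by -q exchanges the two products up to sign, which reduces a
      negative real part to a positive one.\<close>
    have refl: "norm (pochhammer (- x) (Suc n)) = norm (pochhammer (x - of_nat n) (Suc n))" for x :: complex
      by (simp add: pochhammer_minus norm_mult norm_power del: pochhammer_Suc)
    have "norm (pochhammer (- q - of_nat n) (Suc n)) < norm (pochhammer (- q) (Suc n))"
      using 2 assms by (intro norm_pochhammer_less)
    then show ?thesis using refl[of q] refl[of "- q"] assms(1) by simp
  qed
qed

section \<open>Long cycles on an arbitrary finite carrier\<close>

lemma cyclic_on_iff_cycle_count_eq_1:
  assumes "finite S" "p permutes S" "S \<noteq> {}"
  shows "cyclic_on p S \<longleftrightarrow> cycle_count S p = 1"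
proof
  assume "cyclic_on p S"
  then have "orbit p ` S = {S}" using assms(3) orbit_cyclic_eq3[of p S] by auto
  then show "cycle_count S p = 1" by (simp add: cycle_count_def)
next
  assume "cycle_count S p = 1"
  then obtain C where C: "orbit p ` S = {C}" unfolding cycle_count_def by (rule card_1_singletonE)
  obtain x where x: "x \<in> S" using assms(3) by blast
  have perm: "permutation p" using assms by (intro permutes_imp_permutation)
  have "y \<in> orbit p x" if "y \<in> S" for y
  proof -
    have "orbit p y = C" "orbit p x = C" using C that x by blast+
    then show ?thesis using permutation_self_in_orbit[OF perm, of y] by simp
  qed
  then have "S = orbit p x" using permutes_orbit_subset[OF assms(2) x] by blast
  then show "cyclic_on p S" using x by (auto simp: cyclic_on_def)
qed

lemma cycle_count_pos:
  assumes "finite S" "S \<noteq> {}"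
  shows "cycle_count S p > 0"
  using assms by (simp add: cycle_count_def card_gt_0_iff)

text \<open>A version of \<open>F_poly\<close> with a free carrier, so that fixed points can be
  added one at a time.\<close>

definition long_cycle_poly :: "'a set \<Rightarrow> ('a \<Rightarrow> 'a) \<Rightarrow> real poly" where
  "long_cycle_poly S \<pi> =
    (\<Sum>\<zeta> | \<zeta> permutes S \<and> cycle_count S \<zeta> = 1. monom 1 ((cycle_count S (\<pi> \<circ> \<zeta>) - 1) div 2))"

lemma F_poly_eq_long_cycle_poly:
  assumes "n \<ge> 1"
  shows "F_poly n \<pi> = long_cycle_poly {1..n} \<pi>"
proof -
  have "n_cycles n = {\<zeta>. \<zeta> permutes {1..n} \<and> cycle_count {1..n} \<zeta> = 1}"
    unfolding n_cycles_def using assms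
    by (intro Collect_cong conj_cong refl cyclic_on_iff_cycle_count_eq_1) auto
  then show ?thesis
    by (simp add: F_poly_def long_cycle_poly_def num_cycles_def cycles_of_def cycle_count_def)
qed

text \<open>Two long cycles on the same set have equal signs, so their product is even.\<close>

lemma even_card_add_cycle_count:
  assumes S: "finite S" and \<pi>: "\<pi> permutes S" "cycle_count S \<pi> = 1"
    and \<zeta>: "\<zeta> permutes S" "cycle_count S \<zeta> = 1"
  shows "even (card S + cycle_count S (\<pi> \<circ> \<zeta>))"
proof -
  have "sign (\<pi> \<circ> \<zeta>) = sign \<pi> * sign \<zeta>"
    using S \<pi> \<zeta> by (intro sign_compose permutes_imp_permutation)
  also have "\<dots> = 1" using S \<pi> \<zeta> by (simp add: sign_conv_cycle_count)
  finally have "(-1 :: int) ^ (card S + cycle_count S (\<pi> \<circ> \<zeta>)) = 1"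
    using sign_conv_cycle_count[OF S permutes_compose[OF \<zeta>(1) \<pi>(1)]] by simp
  then show ?thesis by (simp add: minus_one_power_iff split: if_splits)
qed

subsection \<open>Real zeros and log-concavity\<close>

lemma map_poly_of_real_sum:
  "map_poly of_real (sum f A) = (\<Sum>a\<in>A. map_poly of_real (f a) :: 'b::{real_algebra_1,comm_semiring_0} poly)"
  by (rule poly_eqI) (simp add: coeff_map_poly coeff_sum)

lemma map_poly_of_real_mult:
  "map_poly complex_of_real (p * q) = map_poly of_real p * map_poly of_real q"
  by (rule poly_eqI) (simp add: coeff_map_poly coeff_mult)

lemma poly_map_poly_of_real:
  "poly (map_poly complex_of_real p) (of_real x) = of_real (poly p x)"
  by (induction p) (auto simp: map_poly_pCons)

lemma parity_exponent:
  fixes m c :: nat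
  assumes "c > 0" "even (m + c)" "m > 0"
  shows "1 + (m - 1) mod 2 + 2 * ((c - 1) div 2) = c"
proof -
  obtain k l where kl: "m = Suc k" "c = Suc l" using assms gr0_implies_Suc by metis
  then have "even k \<longleftrightarrow> even l" using assms(2) by simp
  then have "k mod 2 = l mod 2" by (simp add: mod2_eq_if)
  then show ?thesis using kl mod_mult_div_eq[of l 2] by simp
qed

text \<open>All exponents on the right have the parity of \<open>card S\<close>. A factor q or q^2
  splits off, and a polynomial in q^2 is left.\<close>

lemma poly_long_cycle_poly_square:
  fixes q :: complex
  assumes S: "finite S" and \<pi>: "\<pi> permutes S" and cyc: "cyclic_on \<pi> S"
  shows "q ^ (1 + (card S - 1) mod 2) * poly (map_poly of_real (long_cycle_poly S \<pi>)) (q\<^sup>2) =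
    (\<Sum>\<zeta> | \<zeta> permutes S \<and> cycle_count S \<zeta> = 1. q ^ cycle_count S (\<pi> \<circ> \<zeta>))"
proof -
  have ne: "S \<noteq> {}" using cyc by (auto simp: cyclic_on_def)
  then have "card S > 0" using S by (simp add: card_gt_0_iff)
  have \<pi>1: "cycle_count S \<pi> = 1" using cyc cyclic_on_iff_cycle_count_eq_1[OF S \<pi> ne] by simp
  have "q ^ (1 + (card S - 1) mod 2) * (q\<^sup>2) ^ ((cycle_count S (\<pi> \<circ> \<zeta>) - 1) div 2) =
      q ^ cycle_count S (\<pi> \<circ> \<zeta>)" if "\<zeta> permutes S" "cycle_count S \<zeta> = 1" for \<zeta>
  proof -
    define c where "c = cycle_count S (\<pi> \<circ> \<zeta>)"
    have "c > 0" unfolding c_def by (rule cycle_count_pos[OF S ne])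
    moreover have "even (card S + c)"
      unfolding c_def by (rule even_card_add_cycle_count[OF S \<pi> \<pi>1 that])
    ultimately have "1 + (card S - 1) mod 2 + 2 * ((c - 1) div 2) = c"
      using \<open>card S > 0\<close> by (intro parity_exponent)
    then show ?thesis unfolding c_def[symmetric] by (simp only: flip: power_mult power_add)
  qed
  then show ?thesis
    unfolding long_cycle_poly_def map_poly_of_real_sum poly_sum sum_distrib_left
    by (intro sum.cong) (auto simp: map_poly_monom poly_monom)
qed

lemma long_cycle_poly_zeros:
  fixes z :: complex
  assumes S: "finite S" and \<pi>: "\<pi> permutes S" and cyc: "cyclic_on \<pi> S"
    and z: "poly (map_poly of_real (long_cycle_poly S \<pi>)) z = 0"
  shows "z \<in> \<real> \<and> Re z \<le> 0"
proof (cases "z = 0")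
  case False
  define q where "q = csqrt z"
  have q: "z = q\<^sup>2" "q \<noteq> 0" using False by (auto simp: q_def)
  have "S \<noteq> {}" using cyc by (auto simp: cyclic_on_def)
  then have n: "card S \<ge> 1" using S by (simp add: Suc_le_eq card_gt_0_iff)
  have "(\<Sum>\<zeta> | \<zeta> permutes S \<and> cycle_count S \<zeta> = 1. q ^ cycle_count S (\<pi> \<circ> \<zeta>)) = 0"
    using poly_long_cycle_poly_square[OF S \<pi> cyc, of q] z q(1) by simp
  then have "pochhammer q (Suc (card S)) = pochhammer (q - of_nat (card S)) (Suc (card S))"
    using sum_cyclic_closed_form[OF S \<pi> cyc q(2)] by simp
  then have "Re q = 0" using n by (rule Re_eq_0_of_pochhammer_eq)
  \<comment> \<open>The square of a purely imaginary number is real and nonpositive.\<close>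
  then have "q = \<i> * of_real (Im q)" by (simp add: complex_eq_iff)
  then have "z = - of_real ((Im q)\<^sup>2)"
    unfolding q(1) by (metis i_squared mult_minus_left mult_1 of_real_power power_mult_distrib power2_i)
  then show ?thesis by (auto simp flip: of_real_minus of_real_power)
qed auto

text \<open>Linear factors \<open>x + a\<close> with \<open>a \<ge> 0\<close> preserve the nonnegativity of all \<open>2 \<times> 2\<close>
  minors of the coefficient sequence (log-concavity alone is not preserved, because of internal
  zeros).\<close>
lemma coeff_minors_nonneg:
  assumes "lead_coeff p > (0::real)"
    and "\<And>z. poly (map_poly complex_of_real p) z = 0 \<Longrightarrow> z \<in> \<real> \<and> Re z \<le> 0"
  shows "(\<forall>k. coeff p k \<ge> 0) \<and>
    (\<forall>i j. i \<le> j \<longrightarrow> coeff p i * coeff p (Suc j) \<le> coeff p (Suc i) * coeff p j)"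
  using assms
proof (induction "degree p" arbitrary: p)
  case 0
  then obtain c where "p = [:c:]" by (metis degree_eq_zeroE)
  then show ?case using 0 by (auto simp: coeff_pCons split: nat.splits)
next
  case (Suc m)
  have deg: "degree (map_poly complex_of_real p) = degree p" by (rule degree_map_poly) auto
  then obtain z where z: "poly (map_poly complex_of_real p) z = 0"
    using fundamental_theorem_of_algebra[of "map_poly complex_of_real p"] Suc.hyps(2)
    by (auto simp: constant_degree)
  with Suc.prems(2) have "z \<in> \<real>" "Re z \<le> 0" by auto
  define a where "a = - Re z"
  have "a \<ge> 0" using \<open>Re z \<le> 0\<close> by (simp add: a_def)
  have "z = of_real (- a)" using \<open>z \<in> \<real>\<close> by (simp add: a_def)
  then have "poly p (- a) = 0" using z poly_map_poly_of_real[of p "- a"] by simp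
  then obtain r where r: "p = [:a, 1:] * r" by (auto simp: poly_eq_0_iff_dvd)
  have "r \<noteq> 0" using r Suc.prems(1) by auto
  \<comment> \<open>Dividing by the linear factor keeps the leading coefficient and the condition on
    the zeros, so the induction hypothesis applies to \<open>r\<close>.\<close>
  then have "degree p = Suc (degree r)" unfolding r by (subst degree_mult_eq) auto
  moreover have "lead_coeff r = lead_coeff p" unfolding r lead_coeff_mult by simp
  moreover have "w \<in> \<real> \<and> Re w \<le> 0" if "poly (map_poly complex_of_real r) w = 0" for w
    using that Suc.prems(2)[of w] unfolding r map_poly_of_real_mult by simp
  ultimately have IH: "\<And>k. coeff r k \<ge> 0"
      "\<And>i j. i \<le> j \<Longrightarrow> coeff r i * coeff r (Suc j) \<le> coeff r (Suc i) * coeff r j"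
    using Suc.hyps(1)[of r] Suc.hyps(2) Suc.prems(1) by auto
  have p0: "coeff p 0 = a * coeff r 0" and pS: "coeff p (Suc k) = a * coeff r (Suc k) + coeff r k" for k
    unfolding r by simp_all
  have nonneg: "coeff p k \<ge> 0" for k
    using IH(1) \<open>a \<ge> 0\<close> by (cases k) (auto simp: p0 pS)
  have "coeff p i * coeff p (Suc j) \<le> coeff p (Suc i) * coeff p j" if "i \<le> j" for i j
  \<comment> \<open>For \<open>i = j\<close> both sides coincide. Excluding this case gives
    \<open>Suc h \<le> l\<close> below, which the two chained minors behind 3 require.\<close>
  proof (cases "i = j")
    case False
    then have "i < j" using that by simp
    then obtain l where j: "j = Suc l" "i \<le> l" by (cases j) auto
    show ?thesis
    proof (cases i)
      case 0
      have "a * a * (coeff r 0 * coeff r (Suc j)) \<le> a * a * (coeff r (Suc 0) * coeff r j)"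
        using IH(2)[of 0 j] by (intro mult_left_mono) auto
      moreover have "0 \<le> coeff r 0 * coeff r l + a * (coeff r (Suc 0) * coeff r l)"
        using IH(1) \<open>a \<ge> 0\<close> by simp
      ultimately show ?thesis unfolding 0 j(1) p0 pS by (simp add: algebra_simps)
    next
      case (Suc h)
      have "h \<le> l" "Suc h \<le> l" using j Suc by auto
      have 1: "coeff r h * coeff r (Suc l) \<le> coeff r (Suc h) * coeff r l"
        by (rule IH(2)[OF \<open>h \<le> l\<close>])
      have 2: "a * a * (coeff r (Suc h) * coeff r (Suc (Suc l))) \<le>
          a * a * (coeff r (Suc (Suc h)) * coeff r (Suc l))"
        using IH(2)[of "Suc h" "Suc l"] \<open>h \<le> l\<close> by (intro mult_left_mono) auto
      have "coeff r h * coeff r (Suc (Suc l)) \<le> coeff r (Suc h) * coeff r (Suc l)"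
        using IH(2)[of h "Suc l"] \<open>h \<le> l\<close> by auto
      also have "\<dots> \<le> coeff r (Suc (Suc h)) * coeff r l"
        by (rule IH(2)[OF \<open>Suc h \<le> l\<close>])
      finally have 3: "a * (coeff r h * coeff r (Suc (Suc l))) \<le> a * (coeff r (Suc (Suc h)) * coeff r l)"
        using \<open>a \<ge> 0\<close> by (rule mult_left_mono)
      \<comment> \<open>As polynomials in a, the two sides compare coefficientwise by 1, 3 and 2;
        the common term a r(h+1) r(l+1) cancels.\<close>
      show ?thesis unfolding Suc j(1) pS using 1 2 3 by (simp add: algebra_simps)
    qed
  qed (simp add: mult.commute)
  then show ?case using nonneg by blast
qed

lemma log_concave_poly_smult:
  assumes "log_concave_poly p" "c \<ge> 0"
  shows "log_concave_poly (smult c p)"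
proof -
  have "c * c * (coeff p (k - 1) * coeff p (k + 1)) \<le> c * c * (coeff p k)\<^sup>2" if "k \<ge> 1" for k
    using assms that by (intro mult_left_mono) (auto simp: log_concave_poly_def)
  then show ?thesis using assms by (auto simp: log_concave_poly_def power2_eq_square mult_ac)
qed

lemma coeff_long_cycle_poly_nonneg: "coeff (long_cycle_poly S \<pi>) k \<ge> 0"
  by (auto simp: long_cycle_poly_def coeff_sum intro!: sum_nonneg)

lemma log_concave_long_cycle_poly_cyclic:
  assumes S: "finite S" and \<pi>: "\<pi> permutes S" and cyc: "cyclic_on \<pi> S"
  shows "log_concave_poly (long_cycle_poly S \<pi>)"
proof (cases "long_cycle_poly S \<pi> = 0")
  case False
  then have "lead_coeff (long_cycle_poly S \<pi>) > 0"
    using coeff_long_cycle_poly_nonneg[of S \<pi> "degree (long_cycle_poly S \<pi>)"]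
    by (metis leading_coeff_0_iff order_le_less)
  then have *: "\<forall>i j. i \<le> j \<longrightarrow> coeff (long_cycle_poly S \<pi>) i * coeff (long_cycle_poly S \<pi>) (Suc j) \<le>
      coeff (long_cycle_poly S \<pi>) (Suc i) * coeff (long_cycle_poly S \<pi>) j"
    using coeff_minors_nonneg[of "long_cycle_poly S \<pi>"] long_cycle_poly_zeros[OF S \<pi> cyc] by blast
  have "coeff (long_cycle_poly S \<pi>) (k - 1) * coeff (long_cycle_poly S \<pi>) (k + 1) \<le>
      (coeff (long_cycle_poly S \<pi>) k)\<^sup>2" if "k \<ge> 1" for k
    \<comment> \<open>The minor with adjacent indices is exactly the log-concavity
      inequality.\<close>
    using *[rule_format, of "k - 1" k] that by (simp add: power2_eq_square)
  then show ?thesis by (simp add: log_concave_poly_def coeff_long_cycle_poly_nonneg)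
qed (simp add: log_concave_poly_def)

text \<open>Deleting a fixed point \<open>a\<close> of \<open>\<pi>\<close> from the cycle \<open>\<zeta>\<close> merely deletes it
  from a cycle of the product; conversely \<open>a\<close> can be inserted after any of the points of \<open>S\<close>.\<close>
lemma long_cycle_poly_insert:
  assumes S: "finite S" "S \<noteq> {}" and a: "a \<notin> S" and \<pi>: "\<pi> permutes S"
  shows "long_cycle_poly (insert a S) \<pi> = smult (of_nat (card S)) (long_cycle_poly S \<pi>)"
proof -
  have "\<pi> a = a" using a \<pi> by (intro permutes_not_in)
  have filter: "long_cycle_poly T \<pi> = (\<Sum>\<zeta> | \<zeta> permutes T.
      if cycle_count T \<zeta> = 1 then monom 1 ((cycle_count T (\<pi> \<circ> \<zeta>) - 1) div 2) else 0)"
    if "finite T" for T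
    unfolding long_cycle_poly_def
    using sum.inter_filter[OF finite_permutations[OF that],
        of "\<lambda>\<zeta>. monom 1 ((cycle_count T (\<pi> \<circ> \<zeta>) - 1) div 2)" "\<lambda>\<zeta>. cycle_count T \<zeta> = 1"]
    by (simp only: mem_Collect_eq)
  let ?g = "\<lambda>T \<zeta>. if cycle_count T \<zeta> = 1 then monom 1 ((cycle_count T (\<pi> \<circ> \<zeta>) - 1) div 2)
    else 0 :: real poly"
  have ins: "?g (insert a S) (transpose a b \<circ> \<zeta>) = ?g S \<zeta>" if "b \<in> S" "\<zeta> permutes S" for b \<zeta>
  proof -
    \<comment> \<open>Since \<open>\<pi>\<close> fixes \<open>a\<close>, moving it past the
      transposition only replaces \<open>b\<close> by \<open>\<pi> b\<close>. Hence \<open>a\<close>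
      can be removed from \<open>\<zeta>\<close> and from the product simultaneously.\<close>
    have "\<pi> \<circ> (transpose a b \<circ> \<zeta>) = transpose a (\<pi> b) \<circ> (\<pi> \<circ> \<zeta>)"
    proof
      fix x
      have "\<pi> (\<zeta> x) = a \<longleftrightarrow> \<zeta> x = a" "\<pi> (\<zeta> x) = \<pi> b \<longleftrightarrow> \<zeta> x = b"
        using inj_eq[OF permutes_inj[OF \<pi>]] \<open>\<pi> a = a\<close> by metis+
      then show "(\<pi> \<circ> (transpose a b \<circ> \<zeta>)) x = (transpose a (\<pi> b) \<circ> (\<pi> \<circ> \<zeta>)) x"
        using \<open>\<pi> a = a\<close> by (simp add: transpose_def)
    qed
    moreover have "cycle_count (insert a S) (transpose a (\<pi> b) \<circ> (\<pi> \<circ> \<zeta>)) = cycle_count S (\<pi> \<circ> \<zeta>)"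
      using S a \<pi> that
      by (intro cycle_count_insert_transpose permutes_compose) (auto simp: permutes_in_image)
    moreover have "cycle_count (insert a S) (transpose a b \<circ> \<zeta>) = cycle_count S \<zeta>"
      using S a that by (intro cycle_count_insert_transpose)
    ultimately show ?thesis by (simp only:)
  qed
  \<comment> \<open>With \<open>b = a\<close> the point \<open>a\<close> is a separate cycle beside
    those on the nonempty \<open>S\<close>, so the result is not a long cycle.\<close>
  have self: "?g (insert a S) (transpose a a \<circ> \<zeta>) = 0" if "\<zeta> permutes S" for \<zeta>
    using cycle_count_insert[OF S(1) a that] cycle_count_pos[OF S, of \<zeta>] by simp
  have "long_cycle_poly (insert a S) \<pi> = (\<Sum>\<zeta> | \<zeta> permutes insert a S. ?g (insert a S) \<zeta>)"
    using S by (intro filter) auto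
  also have "\<dots> = (\<Sum>b\<in>insert a S. \<Sum>\<zeta> | \<zeta> permutes S. ?g (insert a S) (transpose a b \<circ> \<zeta>))"
    using S(1) a by (rule sum_over_permutations_insert)
  also have "\<dots> = (\<Sum>\<zeta> | \<zeta> permutes S. ?g (insert a S) (transpose a a \<circ> \<zeta>)) +
      (\<Sum>b\<in>S. \<Sum>\<zeta> | \<zeta> permutes S. ?g (insert a S) (transpose a b \<circ> \<zeta>))"
    using S(1) a by (rule sum.insert)
  also have "\<dots> = 0 + (\<Sum>b\<in>S. \<Sum>\<zeta> | \<zeta> permutes S. ?g S \<zeta>)"
    by (intro arg_cong2[of _ _ _ _ "(+)"] sum.cong sum.neutral ballI refl ins self) auto
  also have "\<dots> = smult (of_nat (card S)) (long_cycle_poly S \<pi>)"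
    unfolding filter[OF S(1), symmetric] by (simp add: of_nat_poly)
  finally show ?thesis .
qed

lemma log_concave_long_cycle_poly_superset:
  assumes "finite C" "C \<noteq> {}" "\<pi> permutes C" "cyclic_on \<pi> C" "finite D" "C \<inter> D = {}"
  shows "log_concave_poly (long_cycle_poly (D \<union> C) \<pi>)"
  using assms(5,6)
proof (induction D rule: finite_induct)
  case empty
  then show ?case using assms by (simp add: log_concave_long_cycle_poly_cyclic)
next
  case (insert a D)
  have "long_cycle_poly (insert a (D \<union> C)) \<pi> =
      smult (of_nat (card (D \<union> C))) (long_cycle_poly (D \<union> C) \<pi>)"
    using insert assms by (intro long_cycle_poly_insert) (auto intro: permutes_subset)
  then show ?case using insert by (simp add: log_concave_poly_smult)
qed

lemma log_concave_F_poly: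
  assumes n: "n \<ge> 1" and \<pi>: "\<pi> permutes {1..n}"
    and one: "card {C \<in> cycles_of n \<pi>. card C > 1} \<le> 1"
  shows "log_concave_poly (F_poly n \<pi>)"
proof -
  have perm: "permutation \<pi>" using \<pi> by (intro permutes_imp_permutation) auto
  have fixed: "\<pi> x = x" if "\<not> card (orbit \<pi> x) > 1" for x
  proof -
    have x: "x \<in> orbit \<pi> x" by (rule permutation_self_in_orbit[OF perm])
    then have "card (orbit \<pi> x) \<ge> 1"
      using finite_orbit[OF x] by (auto simp: Suc_le_eq card_gt_0_iff)
    then have "card (orbit \<pi> x) = 1" using that by simp
    then obtain y where "orbit \<pi> x = {y}" by (rule card_1_singletonE)
    then have "orbit \<pi> x = {x}" using x by auto
    then show ?thesis by (simp add: orbit_eq_singleton_iff)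
  qed
  have fin: "finite {C \<in> cycles_of n \<pi>. card C > 1}" by (simp add: cycles_of_def)
  obtain C where C: "C \<subseteq> {1..n}" "\<pi> permutes C" "cyclic_on \<pi> C"
  \<comment> \<open>The core \<open>C\<close> is the unique nontrivial cycle; for the identity the
    fixed point 1 takes its place. All other points are fixed and are added back one at a
    time.\<close>
  proof (cases "{C \<in> cycles_of n \<pi>. card C > 1} = {}")
    case True
    then have id: "\<pi> x = x" if "x \<in> {1..n}" for x
      using that by (intro fixed) (auto simp: cycles_of_def)
    have "\<pi> permutes {1}" using id by (intro permutes_superset[OF \<pi>]) auto
    moreover have "cyclic_on \<pi> {1}"
      using id[of 1] n orbit_eq_singleton_iff[of \<pi> 1] by (auto simp: cyclic_on_def)
    ultimately show thesis using that[of "{1}"] n by auto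
  next
    case False
    then obtain C where C: "C \<in> cycles_of n \<pi>" "card C > 1" by auto
    then have sub: "{C} \<subseteq> {C \<in> cycles_of n \<pi>. card C > 1}" by auto
    have unique: "C' = C" if "C' \<in> cycles_of n \<pi>" "card C' > 1" for C'
      using card_seteq[OF fin sub] one that by auto
    obtain y where y: "y \<in> {1..n}" "C = orbit \<pi> y" using C by (auto simp: cycles_of_def)
    have "\<pi> permutes C"
    proof (rule permutes_superset[OF \<pi>])
      fix x assume "x \<in> {1..n} - C"
      then have "orbit \<pi> x \<noteq> C" using permutation_self_in_orbit[OF perm, of x] by auto
      then show "\<pi> x = x"
        using unique[of "orbit \<pi> x"] \<open>x \<in> {1..n} - C\<close> by (intro fixed) (auto simp: cycles_of_def)
    qed
    moreover have "cyclic_on \<pi> C" unfolding y using perm by (rule cyclic_on_orbit')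
    moreover have "C \<subseteq> {1..n}" unfolding y using permutes_orbit_subset[OF \<pi> y(1)] .
    ultimately show thesis by (rule that[rotated])
  qed
  have "C \<noteq> {}" using C(3) by (auto simp: cyclic_on_def)
  then have "log_concave_poly (long_cycle_poly (({1..n} - C) \<union> C) \<pi>)"
    using C finite_subset[OF C(1)] by (intro log_concave_long_cycle_poly_superset) auto
  moreover have "({1..n} - C) \<union> C = {1..n}" using C(1) by auto
  ultimately show ?thesis using F_poly_eq_long_cycle_poly[OF n] by simp
qed

theorem theorem4p4:
  fixes n :: nat
  assumes "n \<ge> 1"
  shows "(\<forall>\<pi>\<in>n_cycles n. only_real_zeros (F_poly n \<pi>)) \<and>
         (\<forall>r\<in>{1..n}. \<forall>\<pi>. \<pi> permutes {1..n} \<longrightarrow>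
            cycle_type n \<pi> = {#r#} + replicate_mset (n - r) 1 \<longrightarrow>
            log_concave_poly (F_poly n \<pi>)) \<and>
         (\<forall>\<pi>. \<pi> permutes {1..n} \<longrightarrow>
            card {C \<in> cycles_of n \<pi>. card C > 1} \<le> 1 \<longrightarrow>
            log_concave_poly (F_poly n \<pi>))"
proof (intro conjI ballI allI impI)
  fix \<pi> assume "\<pi> \<in> n_cycles n"
  then show "only_real_zeros (F_poly n \<pi>)"
    unfolding only_real_zeros_def F_poly_eq_long_cycle_poly[OF assms] n_cycles_def
    using long_cycle_poly_zeros[of "{1..n}" \<pi>] by auto
next
  fix r \<pi>
  assume \<pi>: "\<pi> permutes {1..n}" and type: "cycle_type n \<pi> = {#r#} + replicate_mset (n - r) 1"
  \<comment> \<open>Only the part \<open>r\<close> can exceed 1, so the claim on cycle types is an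
    instance of the one on permutations with at most one nontrivial cycle.\<close>
  have "card {C \<in> cycles_of n \<pi>. card C > 1} = size (filter_mset (\<lambda>k. k > 1) (cycle_type n \<pi>))"
    unfolding cycle_type_def
    by (simp add: filter_mset_image_mset cycles_of_def)
  also have "\<dots> \<le> 1"
  proof -
    have "size (filter_mset (\<lambda>k. k > 1) (replicate_mset m (1::nat))) = 0" for m
      by (induction m) auto
    moreover have "size (filter_mset (\<lambda>k. k > 1) {#r#}) \<le> 1" by simp
    ultimately show ?thesis
      unfolding type filter_union_mset size_union by (simp only: add_0_right)
  qed
  finally show "log_concave_poly (F_poly n \<pi>)" using assms \<pi> by (intro log_concave_F_poly)
next
  fix \<pi> assume "\<pi> permutes {1..n}" "card {C \<in> cycles_of n \<pi>. card C > 1} \<le> 1"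
  then show "log_concave_poly (F_poly n \<pi>)" using assms by (intro log_concave_F_poly)
qed

end
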